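(* For every integer $r\ge 2$, every connected constraint graph $H$ with at least one edge, and every activity vector $\lambda$ on $H$, there exist positive node-weights $w$ on $H$ such that the $r$-branching $w$-random walk on $H$ induces a simple, invariant Gibbs measure for $\lambda$ on $\hom(\mathbb{T}^r,H)$.
   Context: A constraint graph $H$ is a finite graph with node set $\{1,\dots,q\}$, possibly with loops but no multiple edges; $N(i)$ is the set of nodes adjacent to $i$ (containing $i$ iff $i$ is looped). $\hom(G,H)$ is the set of graph homomorphisms from a countable locally finite loopless graph $G$ (the board, whose vertices are sites) to $H$, with the product $\sigma$-algebra. An activity vector is $\lambda=(\lambda_1,\dots,\lambda_q)$ with all $\lambda_i>0$; for finite $G$ the $\lambda$-measure on $\hom(G,H)$ gives $\varphi$ probability proportional to $\prod_{v}\lambda_{\varphi(v)}$. A patch is a finite set $U$ of sites, $\partial U$ the set of sites outside $U$ adjacent to $U$, $U^+=U\cup\partial U$. A probability measure $\mu$ on $\hom(G,H)$ is a Gibbs measure for $\lambda$ if for every patch $U$ and $\mu$-a.e. $\psi$, the $\mu$-conditional probability that $\varphi|_U=\psi|_U$ given $\varphi|_{G\setminus U}=\psi|_{G\setminus U}$ equals the $\lambda$-measure (on $\hom(U^+,H)$) conditional probability that $\varphi|_U=\psi|_U$ given $\varphi|_{\partial U}=\psi|_{\partial U}$. $\mathbb{T}^r$ is the infinite connected cycle-free graph with all degrees $r+1$. A Gibbs measure on $\hom(T,H)$, $T$ a tree, is simple if for every site $u$ and node $i$, the restrictions of $\varphi$ to the components of $T\setminus\{u\}$ are mutually independent given $\varphi(u)=i$;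 a measure is invariant if it is preserved by every automorphism of the board acting by precomposition. The $r$-branching $w$-random walk (for positive weights $w_i$, $z_i=\sum_{j\in N(i)}w_j$): fix a root $x$, choose $\varphi(x)=i$ with probability proportional to $w_iz_i$, and going outward give each non-root site $v$ with parent $u$ spin $j\in N(\varphi(u))$ with probability $w_j/z_{\varphi(u)}$, independently given $\varphi(u)$; its law is the induced measure. *)

theory Defs
  imports "HOL-Probability.Probability"
begin

text \<open>Concrete model of T^r: sites are lists of naturals; the root is the empty list,
  which has r+1 children [j] (j < r+1); every other site xs has the r children xs @ [j]
  (j < r) and its parent butlast xs.  Hence every site has degree r+1, and the graph is
  an infinite connected cycle-free graph.\<close>

definition tree_sites :: "nat \<Rightarrow> nat list set" where
  "tree_sites r = {xs. xs = [] \<or> (hd xs < r + 1 \<and> (\<forall>j\<in>set (tl xs). j < r))}"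

definition tree_adj :: "nat \<Rightarrow> nat list \<Rightarrow> nat list \<Rightarrow> bool" where
  "tree_adj r u v \<longleftrightarrow> u \<in> tree_sites r \<and> v \<in> tree_sites r \<and>
     ((v \<noteq> [] \<and> u = butlast v) \<or> (u \<noteq> [] \<and> v = butlast u))"

definition constraint_graph :: "nat \<Rightarrow> (nat \<Rightarrow> nat \<Rightarrow> bool) \<Rightarrow> bool" where
  "constraint_graph q E \<longleftrightarrow>
     (\<forall>i j. E i j \<longrightarrow> i \<in> {1..q} \<and> j \<in> {1..q}) \<and> (\<forall>i j. E i j \<longrightarrow> E j i)"

definition nbhd :: "nat \<Rightarrow> (nat \<Rightarrow> nat \<Rightarrow> bool) \<Rightarrow> nat \<Rightarrow> nat set" where
  "nbhd q E i = {j \<in> {1..q}. E i j}"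

definition cg_connected :: "nat \<Rightarrow> (nat \<Rightarrow> nat \<Rightarrow> bool) \<Rightarrow> bool" where
  "cg_connected q E \<longleftrightarrow> (\<forall>i\<in>{1..q}. \<forall>j\<in>{1..q}. E\<^sup>*\<^sup>* i j)"

definition homs :: "'v set \<Rightarrow> ('v \<Rightarrow> 'v \<Rightarrow> bool) \<Rightarrow> nat \<Rightarrow> (nat \<Rightarrow> nat \<Rightarrow> bool)
     \<Rightarrow> ('v \<Rightarrow> nat) set" where
  "homs V G q E = {\<phi> \<in> V \<rightarrow>\<^sub>E {1..q}. \<forall>u\<in>V. \<forall>v\<in>V. G u v \<longrightarrow> E (\<phi> u) (\<phi> v)}"

definition hom_space :: "'v set \<Rightarrow> ('v \<Rightarrow> 'v \<Rightarrow> bool) \<Rightarrow> nat \<Rightarrow> (nat \<Rightarrow> nat \<Rightarrow> bool)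
     \<Rightarrow> ('v \<Rightarrow> nat) measure" where
  "hom_space V G q E = restrict_space (PiM V (\<lambda>_. count_space {1..q})) (homs V G q E)"

definition bdry :: "'v set \<Rightarrow> ('v \<Rightarrow> 'v \<Rightarrow> bool) \<Rightarrow> 'v set \<Rightarrow> 'v set" where
  "bdry V G U = {v \<in> V - U. \<exists>u\<in>U. G u v}"

definition lam_weight :: "(nat \<Rightarrow> real) \<Rightarrow> 'v set \<Rightarrow> ('v \<Rightarrow> nat) \<Rightarrow> real" where
  "lam_weight lam W chi = (\<Prod>v\<in>W. lam (chi v))"

text \<open>The lam-measure (on hom(U^+,H), U^+ the induced subgraph) conditional probability
  that the configuration agrees with sigma on U, given that it agrees with psi on the
  boundary of U.\<close>

definition spec_cond :: "'v set \<Rightarrow> ('v \<Rightarrow> 'v \<Rightarrow> bool) \<Rightarrow> nat \<Rightarrow> (nat \<Rightarrow> nat \<Rightarrow> bool)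
     \<Rightarrow> (nat \<Rightarrow> real) \<Rightarrow> 'v set \<Rightarrow> ('v \<Rightarrow> nat) \<Rightarrow> ('v \<Rightarrow> nat) \<Rightarrow> real" where
  "spec_cond V G q E lam U \<sigma> \<psi> =
     (let Up = U \<union> bdry V G U; Hs = homs Up G q E in
       (\<Sum>chi\<in>{chi\<in>Hs. (\<forall>u\<in>U. chi u = \<sigma> u) \<and> (\<forall>v\<in>bdry V G U. chi v = \<psi> v)}.
           lam_weight lam Up chi) /
       (\<Sum>chi\<in>{chi\<in>Hs. \<forall>v\<in>bdry V G U. chi v = \<psi> v}. lam_weight lam Up chi))"

definition outside_alg :: "'v set \<Rightarrow> ('v \<Rightarrow> 'v \<Rightarrow> bool) \<Rightarrow> nat \<Rightarrow> (nat \<Rightarrow> nat \<Rightarrow> bool)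
     \<Rightarrow> 'v set \<Rightarrow> ('v \<Rightarrow> nat) measure" where
  "outside_alg V G q E U =
     sigma (space (hom_space V G q E))
       {{\<phi> \<in> space (hom_space V G q E). \<phi> v = i} | v i. v \<in> V - U}"

definition gibbs :: "'v set \<Rightarrow> ('v \<Rightarrow> 'v \<Rightarrow> bool) \<Rightarrow> nat \<Rightarrow> (nat \<Rightarrow> nat \<Rightarrow> bool)
     \<Rightarrow> (nat \<Rightarrow> real) \<Rightarrow> ('v \<Rightarrow> nat) measure \<Rightarrow> bool" where
  "gibbs V G q E lam \<mu> \<longleftrightarrow>
     prob_space \<mu> \<and> sets \<mu> = sets (hom_space V G q E) \<and>
     (\<forall>U. finite U \<and> U \<subseteq> V \<longrightarrow>
        (\<forall>\<sigma>. AE \<psi> in \<mu>. (\<forall>u\<in>U. \<psi> u = \<sigma> u) \<longrightarrow>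
            real_cond_exp \<mu> (outside_alg V G q E U)
               (indicator {\<phi> \<in> space \<mu>. \<forall>u\<in>U. \<phi> u = \<sigma> u}) \<psi>
            = spec_cond V G q E lam U \<sigma> \<psi>))"

definition comp_of :: "('v \<Rightarrow> 'v \<Rightarrow> bool) \<Rightarrow> 'v \<Rightarrow> 'v \<Rightarrow> 'v set" where
  "comp_of G u v = {y. (\<lambda>a b. G a b \<and> a \<noteq> u \<and> b \<noteq> u)\<^sup>*\<^sup>* v y}"

definition simple_gibbs :: "'v set \<Rightarrow> ('v \<Rightarrow> 'v \<Rightarrow> bool) \<Rightarrow> nat \<Rightarrow> (nat \<Rightarrow> nat \<Rightarrow> bool)
     \<Rightarrow> (nat \<Rightarrow> real) \<Rightarrow> ('v \<Rightarrow> nat) measure \<Rightarrow> bool" where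
  "simple_gibbs V G q E lam \<mu> \<longleftrightarrow>
     gibbs V G q E lam \<mu> \<and>
     (\<forall>u\<in>V. \<forall>i\<in>{1..q}.
        emeasure \<mu> {\<phi> \<in> space \<mu>. \<phi> u = i} \<noteq> 0 \<longrightarrow>
        prob_space.indep_vars (uniform_measure \<mu> {\<phi> \<in> space \<mu>. \<phi> u = i})
          (\<lambda>v. PiM (comp_of G u v) (\<lambda>_. count_space {1..q}))
          (\<lambda>v \<phi>. restrict \<phi> (comp_of G u v))
          {v \<in> V. G u v})"

definition board_aut :: "'v set \<Rightarrow> ('v \<Rightarrow> 'v \<Rightarrow> bool) \<Rightarrow> ('v \<Rightarrow> 'v) \<Rightarrow> bool" where
  "board_aut V G \<alpha> \<longleftrightarrow> bij_betw \<alpha> V V \<and> (\<forall>u\<in>V. \<forall>v\<in>V. G u v \<longleftrightarrow> G (\<alpha> u) (\<alpha> v))"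

definition invariant_meas :: "'v set \<Rightarrow> ('v \<Rightarrow> 'v \<Rightarrow> bool) \<Rightarrow> nat \<Rightarrow> (nat \<Rightarrow> nat \<Rightarrow> bool)
     \<Rightarrow> ('v \<Rightarrow> nat) measure \<Rightarrow> bool" where
  "invariant_meas V G q E \<mu> \<longleftrightarrow>
     (\<forall>\<alpha>. board_aut V G \<alpha> \<longrightarrow>
        distr \<mu> (hom_space V G q E) (\<lambda>\<phi>. restrict (\<phi> \<circ> \<alpha>) V) = \<mu>)"

definition zw :: "nat \<Rightarrow> (nat \<Rightarrow> nat \<Rightarrow> bool) \<Rightarrow> (nat \<Rightarrow> real) \<Rightarrow> nat \<Rightarrow> real" where
  "zw q E w i = (\<Sum>j\<in>nbhd q E i. w j)"

text \<open>mu is the law of the r-branching w-random walk rooted at the root [] of T^r: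
  its marginal on every ball {v. length v \<le> n} around the root is given by the
  root distribution (proportional to w_i z_i) times the independent transition
  probabilities w_j / z_(parent spin).  These marginals determine the measure.\<close>

definition walk_law :: "nat \<Rightarrow> nat \<Rightarrow> (nat \<Rightarrow> nat \<Rightarrow> bool) \<Rightarrow> (nat \<Rightarrow> real)
     \<Rightarrow> (nat list \<Rightarrow> nat) measure \<Rightarrow> bool" where
  "walk_law r q E w \<mu> \<longleftrightarrow>
     prob_space \<mu> \<and> sets \<mu> = sets (hom_space (tree_sites r) (tree_adj r) q E) \<and>
     (\<forall>n \<psi>. (\<forall>v\<in>tree_sites r. length v \<le> n \<longrightarrow> \<psi> v \<in> {1..q}) \<longrightarrow>
        measure \<mu> {\<phi> \<in> space \<mu>. \<forall>v\<in>tree_sites r. length v \<le> n \<longrightarrow> \<phi> v = \<psi> v} =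
        w (\<psi> []) * zw q E w (\<psi> []) / (\<Sum>i\<in>{1..q}. w i * zw q E w i) *
        (\<Prod>v\<in>{v \<in> tree_sites r. length v \<le> n \<and> v \<noteq> []}.
            (if \<psi> v \<in> nbhd q E (\<psi> (butlast v))
             then w (\<psi> v) / zw q E w (\<psi> (butlast v)) else 0)))"

end

(* The walk built from weights w is a Gibbs measure for the activities w i / z i ^ r, because in the
   probability of a configuration on a ball every inner site contributes w / z ^ r. So w has to solve
   w i = c * lam i * z i ^ r; such weights arise as the critical point of the quadratic form
   sum over edges of w i * w j on a sphere of an (r + 1) / r norm, where connectedness of the
   constraint graph forces the maximiser to be positive. The walk is reversible, so adding a leaf v at
   a site u to a finite subtree multiplies the probability of a cylinder by the transition
   probability from the spin of u to the spin of v, whether v is a child or the parent of u.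
   This rule does not mention the root, and gives invariance and the independence of the branches. *)

theory Submission
  imports Defs
begin

section \<open>Weights with prescribed activities\<close>

text \<open>The factor \<open>c\<close> is a Lagrange multiplier in disguise. It is harmless: a
  patch \<open>U\<close> picks up \<open>c ^ card U\<close> whatever its spins, and conditional
  probabilities are ratios. The substitution \<open>w i = x i ^ r\<close> makes both the form and
  the norm polynomial. As both are homogeneous, a quotient of degree zero replaces the constraint,
  and the maximum property becomes an inequality on the whole nonnegative orthant that can be tested
  by moving one coordinate. The obstacle on the tree side is that the list model singles out a root,
  with \<open>r + 1\<close> children, and a parent relation, none of which automorphisms respect.
  Finite subtrees therefore occur in two forms: with a top, where the probability is an explicit
  product, and as sets grown along edges from any site, a form that automorphisms preserve and that
  fits the branches. Statements about infinite configurations are reduced to cylinders over an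
  increasing sequence of finite sets, which generate the relevant sigma-algebra and, with the empty
  set, are closed under intersection.\<close>

lemma power_affine_bound:
  fixes a b :: real
  assumes "a \<ge> 0" "b \<ge> 0"
  shows "\<exists>C\<ge>0. \<forall>s\<in>{0..1}. (a + b * s) ^ n \<le> a ^ n + C * s"
proof (induction n)
  case 0
  then show ?case by auto
next
  case (Suc n)
  then obtain C where C: "C \<ge> 0" "\<And>s. s \<in> {0..1} \<Longrightarrow> (a + b * s) ^ n \<le> a ^ n + C * s"
    by auto
  have "(a + b * s) ^ Suc n \<le> a ^ Suc n + (C * a + b * a ^ n + C * b) * s" if s: "s \<in> {0..1}" for s
  proof -
    have "(a + b * s) ^ Suc n \<le> (a + b * s) * (a ^ n + C * s)"
      using C(2)[OF s] assms s by (simp add: mult_left_mono)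
    also have "\<dots> = a ^ Suc n + (C * a + b * a ^ n + C * b * s) * s"
      by (simp add: algebra_simps)
    also have "\<dots> \<le> a ^ Suc n + (C * a + b * a ^ n + C * b) * s"
      using C(1) assms s by (intro add_left_mono mult_right_mono) (auto simp: mult_left_le)
    finally show ?thesis .
  qed
  moreover have "C * a + b * a ^ n + C * b \<ge> 0"
    using C(1) assms by auto
  ultimately show ?case by blast
qed

text \<open>The quadratic form counts ordered pairs, hence the factor 2 and the loop term.\<close>

lemma quadratic_form_update:
  fixes a :: "'a \<Rightarrow> 'a \<Rightarrow> real"
  assumes "finite I" "k \<in> I" "\<And>i j. a i j = a j i"
  shows "(\<Sum>i\<in>I. \<Sum>j\<in>I. a i j * (x(k := x k + d)) i * (x(k := x k + d)) j) =
    (\<Sum>i\<in>I. \<Sum>j\<in>I. a i j * x i * x j) + 2 * d * (\<Sum>j\<in>I. a k j * x j) + a k k * d\<^sup>2"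
proof -
  have u: "(x(k := x k + d)) i = x i + (if i = k then d else 0)" for i
    by simp
  have s: "(\<Sum>i\<in>I. \<Sum>j\<in>I. a i j * x i * (if j = k then d else 0)) = d * (\<Sum>j\<in>I. a k j * x j)"
    using assms by (simp add: if_distrib sum.delta sum_distrib_left mult_ac cong: if_cong)
  have s2: "(\<Sum>i\<in>I. \<Sum>j\<in>I. a i j * (if i = k then d else 0) * x j) = d * (\<Sum>j\<in>I. a k j * x j)"
    unfolding s[symmetric] by (subst sum.swap) (auto intro!: sum.cong simp: assms(3))
  have s3: "(\<Sum>i\<in>I. \<Sum>j\<in>I. a i j * (if i = k then d else 0) * (if j = k then d else 0)) = a k k * d\<^sup>2"
  proof -
    have "(\<Sum>i\<in>I. \<Sum>j\<in>I. a i j * (if i = k then d else 0) * (if j = k then d else 0)) =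
      (\<Sum>i\<in>I. if i = k then \<Sum>j\<in>I. if j = k then a k k * d\<^sup>2 else 0 else 0)"
      by (intro sum.cong) (auto intro!: sum.cong sum.neutral simp: power2_eq_square)
    then show ?thesis using assms by (simp add: sum.delta)
  qed
  show ?thesis
    unfolding u by (simp only: distrib_left distrib_right sum.distrib s s2 s3)
qed

text \<open>The set splits, according to a coordinate that attains the value 1, into finitely many
  products of compact factors, so Tychonoff applies. Coordinates outside \<open>I\<close> are pinned
  to 0 because the functions live on the whole type.\<close>

lemma compact_sup_sphere:
  fixes I :: "'a set"
  assumes "finite I"
  shows "compact {x :: 'a \<Rightarrow> real. (\<forall>i. x i \<in> {0..1}) \<and> (\<forall>i. i \<notin> I \<longrightarrow> x i = 0) \<and> (\<exists>i\<in>I. x i = 1)}"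
proof -
  have eq: "{x :: 'a \<Rightarrow> real. (\<forall>i. x i \<in> {0..1}) \<and> (\<forall>i. i \<notin> I \<longrightarrow> x i = 0) \<and> (\<exists>i\<in>I. x i = 1)} =
    (\<Union>k\<in>I. PiE UNIV (\<lambda>i. if i = k then {1} else if i \<in> I then {0..1} else {0}))"
    by (fastforce simp: PiE_iff split: if_splits)
  have "compact (PiE UNIV (\<lambda>i. if i = k then {1} else if i \<in> I then {0..1} else {0::real}))" for k
    unfolding compactin_euclidean_iff[symmetric] euclidean_product_topology[symmetric]
    by (subst compactin_PiE) auto
  then show ?thesis
    unfolding eq using assms by (intro compact_UN) auto
qed

text \<open>At a maximiser of the ratio of the quadratic form to the appropriate power of
  \<open>\<Sum>i. m i * x i ^ Suc r\<close> (with \<open>x i ^ r\<close> the weights) the coordinate-wise critical point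
  equations are the weight equations. A zero coordinate next to a positive one is impossible,
  since raising it to \<open>t\<close> increases the form by order \<open>t ^ r\<close> and the norm by order \<open>t ^ Suc r\<close>.\<close>

lemma critical_weights:
  fixes I :: "'a set" and a :: "'a \<Rightarrow> 'a \<Rightarrow> real" and m :: "'a \<Rightarrow> real"
  assumes I: "finite I" and r: "r \<ge> 1" and m: "\<And>i. i \<in> I \<Longrightarrow> m i > 0"
    and a: "\<And>i j. a i j = a j i" "\<And>i j. a i j \<ge> 0"
    and edge: "i0 \<in> I" "j0 \<in> I" "a i0 j0 > 0"
    and con: "\<And>A. A \<subseteq> I \<Longrightarrow> A \<noteq> {} \<Longrightarrow> A \<noteq> I \<Longrightarrow> \<exists>i\<in>I - A. \<exists>j\<in>A. a i j > 0"
  shows "\<exists>x c. c > 0 \<and> (\<forall>i\<in>I. x i > 0 \<and> x i = c * (\<Sum>j\<in>I. a i j * x j ^ r) / m i)"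
proof -
  define Q where "Q = (\<lambda>x. \<Sum>i\<in>I. \<Sum>j\<in>I. a i j * x i ^ r * x j ^ r)"
  define P where "P = (\<lambda>x. \<Sum>i\<in>I. m i * x i ^ Suc r)"
  define K where "K = {x :: 'a \<Rightarrow> real. (\<forall>i. x i \<in> {0..1}) \<and> (\<forall>i. i \<notin> I \<longrightarrow> x i = 0) \<and> (\<exists>i\<in>I. x i = 1)}"
  \<comment> \<open>\<open>Q\<close> is homogeneous of degree \<open>2 * r\<close> and
    \<open>P\<close> of degree \<open>Suc r\<close>. The two exponents make \<open>F\<close> of
    degree zero, so it may be maximised on any compact set that meets every nonnegative ray;
    \<open>K\<close> is the sup-norm sphere.\<close>
  define F where "F = (\<lambda>x. Q x ^ Suc r / P x ^ (2 * r))"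
  have Q_nonneg: "Q x \<ge> 0" if "\<And>i. i \<in> I \<Longrightarrow> x i \<ge> 0" for x
    unfolding Q_def using that a(2) by (intro sum_nonneg mult_nonneg_nonneg) auto
  have P_pos: "P x > 0" if "\<And>i. i \<in> I \<Longrightarrow> x i \<ge> 0" "k \<in> I" "x k > 0" for x k
  proof -
    have "0 < m k * x k ^ Suc r" using that m by simp
    also have "\<dots> \<le> P x" unfolding P_def using that m I
      by (intro member_le_sum) (auto intro!: mult_nonneg_nonneg simp: less_imp_le)
    finally show ?thesis .
  qed
  have K_pos: "P x > 0" if "x \<in> K" for x
    using that unfolding K_def by (auto intro!: P_pos)
  have "continuous_on K F"
    unfolding F_def
  proof (intro continuous_intros)
    have coord: "continuous_on K (\<lambda>x. x i)" for i
      by (rule continuous_on_subset[OF continuous_on_product_coordinates]) simp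
    show "continuous_on K Q" unfolding Q_def by (intro continuous_intros coord)
    show "continuous_on K P" unfolding P_def by (intro continuous_intros coord)
    show "\<forall>x\<in>K. P x ^ (2 * r) \<noteq> 0" using K_pos by (metis less_irrefl zero_less_power)
  qed
  moreover have "compact K" unfolding K_def by (rule compact_sup_sphere[OF I])
  moreover have oneK: "(\<lambda>i. if i \<in> I then 1 else 0) \<in> K"
    using edge unfolding K_def by auto
  ultimately obtain x where x: "x \<in> K" and max: "\<And>y. y \<in> K \<Longrightarrow> F y \<le> F x"
    using continuous_attains_sup[of K F] by blast
  define M where "M = F x"
  have x0: "x i \<ge> 0" for i using x unfolding K_def by auto
  have "Q (\<lambda>i. if i \<in> I then 1 else 0) > 0"
  proof -
    have "0 < a i0 j0" by fact
    also have "\<dots> \<le> (\<Sum>j\<in>I. a i0 j)" using edge I a by (intro member_le_sum) auto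
    also have "\<dots> \<le> (\<Sum>i\<in>I. \<Sum>j\<in>I. a i j)"
      using edge I a by (intro member_le_sum[of i0 I "\<lambda>i. \<Sum>j\<in>I. a i j"]) (auto intro: sum_nonneg)
    finally show ?thesis unfolding Q_def by simp
  qed
  then have M: "M > 0"
    using max[OF oneK] K_pos[OF oneK] unfolding F_def M_def
    by (meson less_le_trans zero_less_divide_iff zero_less_power)
  \<comment> \<open>Division by the largest coordinate moves any nonzero \<open>y\<close> into
    \<open>K\<close>. Equality holds at \<open>x\<close>, so single coordinates of \<open>x\<close>
    may from here on be varied without returning to a sphere.\<close>
  have key: "Q y ^ Suc r \<le> M * P y ^ (2 * r)" if y: "\<And>i. i \<in> I \<Longrightarrow> y i \<ge> 0" for y
  proof (cases "\<exists>i\<in>I. y i > 0")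
    case False
    then have "y i = 0" if "i \<in> I" for i using y that by force
    then have "Q y = 0" using r unfolding Q_def by (simp add: power_0_left)
    moreover have "P y \<ge> 0" unfolding P_def using y m
      by (intro sum_nonneg mult_nonneg_nonneg) (auto simp: less_imp_le)
    ultimately show ?thesis using M by simp
  next
    case True
    define s where "s = Max (y ` I)"
    have s_ge: "y i \<le> s" if "i \<in> I" for i using that I unfolding s_def by simp
    obtain k where k: "k \<in> I" "y k = s"
      using Max_in[of "y ` I"] I edge(1) unfolding s_def by (metis empty_iff finite_imageI imageE image_eqI)
    have s: "s > 0" using True s_ge by force
    define v where "v = (\<lambda>i. if i \<in> I then y i / s else 0)"
    have v: "v \<in> K" using s_ge y s k unfolding K_def v_def by (auto intro!: bexI[of _ k])
    have Q: "Q y = s ^ (2 * r) * Q v"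
      unfolding Q_def sum_distrib_left v_def using s
      by (intro sum.cong) (auto simp: power_divide field_simps power_add mult_2 mult_2_right)
    have P: "P y = s ^ Suc r * P v"
      unfolding P_def sum_distrib_left v_def using s
      by (intro sum.cong) (auto simp: power_divide field_simps)
    have "Q v ^ Suc r \<le> M * P v ^ (2 * r)"
      using max[OF v] K_pos[OF v] unfolding F_def M_def by (simp add: field_simps)
    then have "s ^ (2 * r * Suc r) * Q v ^ Suc r \<le> s ^ (2 * r * Suc r) * (M * P v ^ (2 * r))"
      using s by (intro mult_left_mono) auto
    then show ?thesis
      unfolding Q P by (simp only: power_mult_distrib power_mult[symmetric] mult_ac)
  qed
  define z where "z = (\<lambda>i. \<Sum>j\<in>I. a i j * x j ^ r)"
  define p q where "p = P x" and "q = Q x"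
  have p: "p > 0" using K_pos[OF x] unfolding p_def .
  have Mpq: "M * p ^ (2 * r) = q ^ Suc r" using p unfolding M_def F_def p_def q_def by simp
  have q: "q > 0"
  proof -
    have "q \<noteq> 0" using Mpq M p by (metis less_irrefl mult_pos_pos power_0_Suc zero_less_power)
    then show ?thesis using Q_nonneg[of x] x0 unfolding q_def by (metis less_eq_real_def)
  qed
  have z0: "z i \<ge> 0" for i unfolding z_def using a x0 by (intro sum_nonneg mult_nonneg_nonneg) auto
  have P_upd: "P (x(i := t)) = p + m i * (t ^ Suc r - x i ^ Suc r)" if "i \<in> I" for i t
  proof -
    have "P (x(i := t)) - m i * t ^ Suc r = p - m i * x i ^ Suc r"
      unfolding P_def p_def using that I by (simp add: sum.remove[of I i])
    then show ?thesis by (simp add: algebra_simps)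
  qed
  have Q_upd: "Q (x(i := t)) = q + 2 * (t ^ r - x i ^ r) * z i + a i i * (t ^ r - x i ^ r)\<^sup>2" if "i \<in> I" for i t
  proof -
    \<comment> \<open>The form is quadratic in the powers \<open>x i ^ r\<close>, so replacing
      \<open>x i\<close> by \<open>t\<close> is an update by \<open>t ^ r - x i ^ r\<close>.\<close>
    have *: "((\<lambda>i. x i ^ r)(i := x i ^ r + (t ^ r - x i ^ r))) k = (x(i := t)) k ^ r" for k
      by simp
    show ?thesis
      using quadratic_form_update[OF I that a(1), where x = "\<lambda>i. x i ^ r" and d = "t ^ r - x i ^ r"]
      unfolding * Q_def q_def z_def .
  qed
  have ineq: "(q + 2 * (t ^ r - x i ^ r) * z i + a i i * (t ^ r - x i ^ r)\<^sup>2) ^ Suc r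
      \<le> M * (p + m i * (t ^ Suc r - x i ^ Suc r)) ^ (2 * r)" if "i \<in> I" "t \<ge> 0" for i t
    unfolding P_upd[OF that(1), symmetric] Q_upd[OF that(1), symmetric]
    using that x0 by (intro key) auto
  have pos: "x i > 0" if "i \<in> I" for i
  proof (rule ccontr)
    assume "\<not> x i > 0"
    define A where "A = {i\<in>I. x i > 0}"
    have "A \<noteq> I" using that \<open>\<not> x i > 0\<close> unfolding A_def by blast
    moreover have "A \<noteq> {}" using x unfolding K_def A_def by force
    ultimately obtain k l where kl: "k \<in> I - A" "l \<in> A" "a k l > 0"
      using con[of A] unfolding A_def by blast
    have xk: "k \<in> I" "x k = 0" using kl x0[of k] unfolding A_def by auto
    have "0 < a k l * x l ^ r" using kl unfolding A_def by simp
    also have "\<dots> \<le> z k" unfolding z_def using kl a x0 I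
      by (intro member_le_sum[of l I "\<lambda>j. a k j * x j ^ r"]) (auto simp: A_def)
    finally have zk: "z k > 0" .
    \<comment> \<open>Raising the zero coordinate to \<open>t\<close> enlarges \<open>P\<close> by
      \<open>m k * t ^ Suc r\<close>; the affine bound makes the growth of the power of
      \<open>P\<close> linear in \<open>t ^ Suc r\<close>.\<close>
    obtain C where C: "C \<ge> 0" "\<And>s. s \<in> {0..1} \<Longrightarrow> (p + m k * s) ^ (2 * r) \<le> p ^ (2 * r) + C * s"
      using power_affine_bound[of p "m k" "2 * r"] p m[OF xk(1)] by auto
    \<comment> \<open>The loop term \<open>a k k\<close> only increases the form and is dropped.
      Division by \<open>t ^ r\<close> leaves a positive constant bounded by a multiple of
      \<open>t\<close>, which fails for small \<open>t\<close>.\<close>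
    have bound: "2 * z k * q ^ r \<le> M * C * t" if t: "0 < t" "t \<le> 1" for t
    proof -
      have t1: "t ^ Suc r \<in> {0..1}" using t by (auto intro!: power_le_one simp del: power_Suc)
      define d where "d = 2 * t ^ r * z k"
      have d: "d \<ge> 0" unfolding d_def using t zk by simp
      have "q ^ Suc r + d * q ^ r \<le> (q + d) * (q + d) ^ r"
      proof -
        have "q ^ Suc r + d * q ^ r = (q + d) * q ^ r" by (simp add: algebra_simps)
        also have "\<dots> \<le> (q + d) * (q + d) ^ r"
          using q d by (intro mult_left_mono power_mono) auto
        finally show ?thesis .
      qed
      also have "\<dots> = (q + d) ^ Suc r" by simp
      also have "\<dots> \<le> (q + 2 * (t ^ r - x k ^ r) * z k + a k k * (t ^ r - x k ^ r)\<^sup>2) ^ Suc r"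
        using q d a(2)[of k k] xk r unfolding d_def by (intro power_mono) (auto simp: power_0_left)
      also have "\<dots> \<le> M * (p + m k * (t ^ Suc r - x k ^ Suc r)) ^ (2 * r)"
        using ineq[OF xk(1), of t] t by simp
      also have "\<dots> \<le> M * (p ^ (2 * r) + C * t ^ Suc r)"
        using C(2)[OF t1] M xk by simp
      finally have "d * q ^ r \<le> M * C * t ^ Suc r"
        using Mpq by (simp add: algebra_simps)
      then have "t ^ r * (2 * z k * q ^ r) \<le> t ^ r * (M * C * t)"
        unfolding d_def by (simp add: mult_ac)
      then show ?thesis using t by simp
    qed
    define e where "e = 2 * z k * q ^ r"
    have e: "e > 0" using zk q unfolding e_def by simp
    \<comment> \<open>The summand 1 keeps \<open>D\<close> positive even if \<open>C = 0\<close>, so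
      that the quotient in \<open>t\<close> is meaningful.\<close>
    define D where "D = M * C + 1"
    define t where "t = min 1 (e / (2 * D))"
    have D: "D > 0" using M C(1) unfolding D_def by (simp add: add_nonneg_pos)
    then have t: "0 < t" "t \<le> 1" using e unfolding t_def by auto
    have "D * t \<le> D * (e / (2 * D))"
      using D unfolding t_def by (intro mult_left_mono) auto
    also have "\<dots> = e / 2" using D by simp
    finally have t': "D * t \<le> e / 2" .
    have "M * C * t < D * t" using t unfolding D_def by simp
    with bound[OF t] t' e show False unfolding e_def[symmetric] by linarith
  qed
  have "x i = (q ^ r / (M * p ^ (2 * r - 1))) * z i / m i" if i: "i \<in> I" for i
  proof -
    \<comment> \<open>\<open>g\<close> is the slack in \<open>ineq\<close>: zero at
      \<open>x i\<close> and nonnegative for all \<open>t \<ge> 0\<close>. Since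
      \<open>x i > 0\<close>, this is an interior minimum. The loop term has derivative zero there
      because it is a square.\<close>
    define g where "g = (\<lambda>t. M * (p + m i * (t ^ Suc r - x i ^ Suc r)) ^ (2 * r) -
      (q + 2 * (t ^ r - x i ^ r) * z i + a i i * (t ^ r - x i ^ r)\<^sup>2) ^ Suc r)"
    have "(g has_real_derivative
       M * (of_nat (2 * r) * p ^ (2 * r - 1) * (m i * (of_nat (Suc r) * x i ^ r))) -
       of_nat (Suc r) * q ^ r * (2 * (of_nat r * x i ^ (r - 1)) * z i)) (at (x i))"
      unfolding g_def
      by (rule derivative_eq_intros refl | simp del: power_Suc of_nat_Suc of_nat_mult)+
    moreover have "0 < x i" by (rule pos[OF i])
    moreover have "\<forall>y. \<bar>x i - y\<bar> < x i \<longrightarrow> g (x i) \<le> g y"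
    proof (intro allI impI)
      fix y assume "\<bar>x i - y\<bar> < x i"
      then have "y \<ge> 0" by linarith
      moreover have "g (x i) = 0" unfolding g_def using Mpq by simp
      ultimately show "g (x i) \<le> g y" using ineq[OF i] unfolding g_def by simp
    qed
    ultimately have "M * (of_nat (2 * r) * p ^ (2 * r - 1) * (m i * (of_nat (Suc r) * x i ^ r))) -
       of_nat (Suc r) * q ^ r * (2 * (of_nat r * x i ^ (r - 1)) * z i) = 0"
      by (rule DERIV_local_min)
    moreover have "x i ^ r = x i * x i ^ (r - 1)" using r by (cases r) auto
    \<comment> \<open>Both derivatives contain \<open>2 * r\<close>, one from the factor 2 and the
      power \<open>x i ^ r\<close>, the other from the exponent of \<open>P\<close>; this,
      \<open>Suc r\<close> and \<open>x i ^ (r - 1)\<close> cancel.\<close>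
    ultimately have "(2 * real r * real (Suc r) * x i ^ (r - 1)) * (M * p ^ (2 * r - 1) * m i * x i)
       = (2 * real r * real (Suc r) * x i ^ (r - 1)) * (q ^ r * z i)"
      by (simp add: algebra_simps)
    moreover have "2 * real r * real (Suc r) * x i ^ (r - 1) \<noteq> 0" using r pos[OF i] by simp
    ultimately have "M * p ^ (2 * r - 1) * m i * x i = q ^ r * z i"
      using mult_left_cancel by blast
    then show ?thesis using M p m[OF i] by (simp add: field_simps)
  qed
  moreover have "q ^ r / (M * p ^ (2 * r - 1)) > 0" using q M p by simp
  ultimately show ?thesis using pos unfolding z_def by blast
qed

text \<open>The critical equation is \<open>x i = c * z i / m i\<close>, with \<open>z i\<close>
  formed from the weights \<open>x j ^ r\<close>. Its r-th power is the required equation as soon as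
  \<open>m i ^ r = 1 / lam i\<close>, which is the origin of the root in \<open>m\<close>; the
  constant becomes \<open>c ^ r\<close>.\<close>

lemma weight_equations_solvable:
  assumes r: "r \<ge> 1" and E: "constraint_graph q E" "cg_connected q E" "E i0 j0"
    and lam: "\<forall>i\<in>{1..q}. lam i > 0"
  shows "\<exists>w c. c > 0 \<and> (\<forall>i\<in>{1..q}. w i > 0 \<and> w i = c * lam i * zw q E w i ^ r)"
proof -
  define a where "a = (\<lambda>i j. if E i j then 1 else 0 :: real)"
  define m where "m = (\<lambda>i. root r (1 / lam i))"
  have sym: "E i j \<longleftrightarrow> E j i" and rng: "E i j \<Longrightarrow> i \<in> {1..q} \<and> j \<in> {1..q}" for i j
    using E(1) unfolding constraint_graph_def by blast+
  have m: "m i > 0" "m i ^ r = 1 / lam i" if "i \<in> {1..q}" for i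
    using that lam r unfolding m_def by (auto simp: real_root_gt_zero real_root_pow_pos)
  have con: "\<exists>i\<in>{1..q} - A. \<exists>j\<in>A. a i j > 0" if A: "A \<subseteq> {1..q}" "A \<noteq> {}" "A \<noteq> {1..q}" for A
  proof (rule ccontr)
    assume c: "\<not> (\<exists>i\<in>{1..q} - A. \<exists>j\<in>A. a i j > 0)"
    obtain u v where uv: "u \<in> A" "v \<in> {1..q} - A" using A by blast
    have "E\<^sup>*\<^sup>* u v" using E(2) uv A unfolding cg_connected_def by blast
    then have "v \<in> A"
    proof (induction rule: rtranclp_induct)
      case (step y z)
      then have "a z y > 0" "z \<in> {1..q}" using sym rng unfolding a_def by auto
      then show ?case using c step.IH by blast
    qed (use uv in auto)
    then show False using uv by blast
  qed
  obtain x c where c: "c > 0" and x: "\<And>i. i \<in> {1..q} \<Longrightarrow> x i > 0 \<and> x i = c * (\<Sum>j\<in>{1..q}. a i j * x j ^ r) / m i"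
  proof -
    have "\<exists>x c. c > 0 \<and> (\<forall>i\<in>{1..q}. x i > 0 \<and> x i = c * (\<Sum>j\<in>{1..q}. a i j * x j ^ r) / m i)"
      by (rule critical_weights[of _ _ _ _ i0 j0])
        (use r m con rng[OF E(3)] sym E(3) in \<open>auto simp: a_def\<close>)
    then show thesis using that by blast
  qed
  define w where "w = (\<lambda>i. x i ^ r)"
  have z: "(\<Sum>j\<in>{1..q}. a i j * x j ^ r) = zw q E w i" for i
    unfolding zw_def nbhd_def a_def w_def by (subst sum.inter_filter, auto intro!: sum.cong)
  have "w i > 0 \<and> w i = c ^ r * lam i * zw q E w i ^ r" if "i \<in> {1..q}" for i
  proof -
    have "w i = (c * zw q E w i / m i) ^ r" using x[OF that] unfolding w_def z by metis
    also have "\<dots> = c ^ r * lam i * zw q E w i ^ r"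
      using m[OF that] lam that by (simp add: power_divide power_mult_distrib)
    finally have "w i = c ^ r * lam i * zw q E w i ^ r" .
    moreover have "w i > 0" unfolding w_def using x[OF that] by (meson zero_less_power)
    ultimately show ?thesis by simp
  qed
  moreover have "c ^ r > 0" using c by simp
  ultimately show ?thesis by blast
qed

section \<open>Cylinder sets\<close>

definition cylinder :: "('v \<Rightarrow> 'c) set \<Rightarrow> 'v set \<Rightarrow> ('v \<Rightarrow> 'c) \<Rightarrow> ('v \<Rightarrow> 'c) set" where
  "cylinder \<Omega> W \<psi> = {\<phi>\<in>\<Omega>. \<forall>v\<in>W. \<phi> v = \<psi> v}"

definition coordinate_events :: "('v \<Rightarrow> 'c) set \<Rightarrow> 'v set \<Rightarrow> ('v \<Rightarrow> 'c) set set" where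
  "coordinate_events \<Omega> S = {{\<phi>\<in>\<Omega>. \<phi> v = i} | v i. v \<in> S}"

lemma cylinder_empty [simp]: "cylinder \<Omega> {} \<psi> = \<Omega>"
  by (auto simp: cylinder_def)

lemma cylinder_subset: "cylinder \<Omega> W \<psi> \<subseteq> \<Omega>"
  by (auto simp: cylinder_def)

lemma coordinate_events_subset: "coordinate_events \<Omega> S \<subseteq> Pow \<Omega>"
  by (auto simp: coordinate_events_def)

lemma cylinder_in_coordinate_algebra:
  assumes "finite W" "W \<subseteq> S"
  shows "cylinder \<Omega> W \<psi> \<in> sigma_sets \<Omega> (coordinate_events \<Omega> S)"
  using assms
proof (induction W)
  case empty
  then show ?case by (simp add: sigma_sets_top)
next
  case (insert v W)
  interpret sigma_algebra \<Omega> "sigma_sets \<Omega> (coordinate_events \<Omega> S)"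
    by (rule sigma_algebra_sigma_sets) (rule coordinate_events_subset)
  have "cylinder \<Omega> (insert v W) \<psi> = {\<phi>\<in>\<Omega>. \<phi> v = \<psi> v} \<inter> cylinder \<Omega> W \<psi>"
    by (auto simp: cylinder_def)
  moreover have "{\<phi>\<in>\<Omega>. \<phi> v = \<psi> v} \<in> sigma_sets \<Omega> (coordinate_events \<Omega> S)"
    using insert by (intro sigma_sets.Basic) (auto simp: coordinate_events_def)
  ultimately show ?case using insert by auto
qed

text \<open>An event that depends only on the spins in the finite set \<open>W\<close> is a union of
  cylinders over \<open>W\<close>, and the finite alphabet leaves only finitely many of
  them.\<close>

lemma determined_in_sigma_algebra:
  assumes "sigma_algebra \<Omega> \<A>" and W: "finite W" "finite C" "\<And>\<phi> v. \<phi> \<in> \<Omega> \<Longrightarrow> v \<in> W \<Longrightarrow> \<phi> v \<in> C"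
    and cyl: "\<And>\<psi>. cylinder \<Omega> W \<psi> \<in> \<A>"
    and A: "A \<subseteq> \<Omega>" "\<And>\<phi> \<eta>. \<phi> \<in> A \<Longrightarrow> \<eta> \<in> \<Omega> \<Longrightarrow> (\<And>v. v \<in> W \<Longrightarrow> \<phi> v = \<eta> v) \<Longrightarrow> \<eta> \<in> A"
  shows "A \<in> \<A>"
proof -
  interpret sigma_algebra \<Omega> \<A> by fact
  have eq: "A = (\<Union>\<psi>\<in>(\<lambda>\<phi>. restrict \<phi> W) ` A. cylinder \<Omega> W \<psi>)"
  proof (intro equalityI subsetI)
    fix \<phi> assume "\<phi> \<in> A"
    then show "\<phi> \<in> (\<Union>\<psi>\<in>(\<lambda>\<phi>. restrict \<phi> W) ` A. cylinder \<Omega> W \<psi>)"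
      using A(1) by (intro UN_I[of "restrict \<phi> W"]) (auto simp: cylinder_def)
  next
    fix \<eta> assume "\<eta> \<in> (\<Union>\<psi>\<in>(\<lambda>\<phi>. restrict \<phi> W) ` A. cylinder \<Omega> W \<psi>)"
    then obtain \<phi> where "\<phi> \<in> A" "\<eta> \<in> \<Omega>" "\<forall>v\<in>W. \<eta> v = \<phi> v" by (auto simp: cylinder_def)
    then show "\<eta> \<in> A" using A(2)[of \<phi> \<eta>] by simp
  qed
  have "finite ((\<lambda>\<phi>. restrict \<phi> W) ` A)"
    by (rule finite_subset[OF _ finite_PiE[of W "\<lambda>_. C"]]) (use W A in auto)
  then show ?thesis by (subst eq) (intro finite_UN cyl)
qed

text \<open>Cylinders over two nested sets are either nested or disjoint, so along an increasing
  sequence they form a pi-system once the empty set is added.\<close>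

definition exhaustion_cylinders :: "('v \<Rightarrow> 'c) set \<Rightarrow> (nat \<Rightarrow> 'v set) \<Rightarrow> ('v \<Rightarrow> 'c) set set" where
  "exhaustion_cylinders \<Omega> D = insert {} {cylinder \<Omega> (D n) \<psi> | n \<psi>. True}"

lemma Int_stable_exhaustion_cylinders:
  assumes "incseq D"
  shows "Int_stable (exhaustion_cylinders \<Omega> D)"
proof -
  have *: "cylinder \<Omega> (D n) \<psi> \<inter> cylinder \<Omega> (D m) \<eta> \<in> exhaustion_cylinders \<Omega> D" if "n \<le> m" for n m \<psi> \<eta>
  proof (cases "\<forall>v\<in>D n. \<psi> v = \<eta> v")
    case True
    then have "cylinder \<Omega> (D n) \<psi> \<inter> cylinder \<Omega> (D m) \<eta> = cylinder \<Omega> (D m) \<eta>"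
      using incseqD[OF assms that] by (auto simp: cylinder_def subset_iff)
    then show ?thesis by (auto simp: exhaustion_cylinders_def)
  next
    case False
    then have "cylinder \<Omega> (D n) \<psi> \<inter> cylinder \<Omega> (D m) \<eta> = {}"
      using incseqD[OF assms that] by (auto simp: cylinder_def subset_iff)
    then show ?thesis by (auto simp: exhaustion_cylinders_def)
  qed
  show ?thesis
  proof (rule Int_stableI)
    fix a b assume ab: "a \<in> exhaustion_cylinders \<Omega> D" "b \<in> exhaustion_cylinders \<Omega> D"
    show "a \<inter> b \<in> exhaustion_cylinders \<Omega> D"
    proof (cases "a = {} \<or> b = {}")
      case True
      then show ?thesis by (auto simp: exhaustion_cylinders_def)
    next
      case False
      then obtain n m \<psi> \<eta> where "a = cylinder \<Omega> (D n) \<psi>" "b = cylinder \<Omega> (D m) \<eta>"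
        using ab by (auto simp: exhaustion_cylinders_def)
      then show ?thesis using *[of n m] *[of m n] by (metis Int_commute linear)
    qed
  qed
qed

lemma exhaustion_cylinders_subset: "exhaustion_cylinders \<Omega> D \<subseteq> Pow \<Omega>"
  using cylinder_subset by (force simp: exhaustion_cylinders_def)

lemma sigma_sets_exhaustion_cylinders:
  assumes D: "\<And>n. finite (D n)" "(\<Union>n. D n) = S"
    and C: "finite C" "\<And>\<phi> v. \<phi> \<in> \<Omega> \<Longrightarrow> v \<in> S \<Longrightarrow> \<phi> v \<in> C"
  shows "sigma_sets \<Omega> (exhaustion_cylinders \<Omega> D) = sigma_sets \<Omega> (coordinate_events \<Omega> S)"
proof (rule sigma_sets_eqI)
  fix A assume "A \<in> exhaustion_cylinders \<Omega> D"
  then consider "A = {}" | n \<psi> where "A = cylinder \<Omega> (D n) \<psi>"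
    by (auto simp: exhaustion_cylinders_def)
  then show "A \<in> sigma_sets \<Omega> (coordinate_events \<Omega> S)"
  proof cases
    case 1
    then show ?thesis by (simp add: sigma_sets.Empty)
  next
    case 2
    then show ?thesis using D by (auto intro!: cylinder_in_coordinate_algebra)
  qed
next
  fix A assume "A \<in> coordinate_events \<Omega> S"
  then obtain v i where A: "A = {\<phi>\<in>\<Omega>. \<phi> v = i}" "v \<in> S"
    by (auto simp: coordinate_events_def)
  then obtain n where n: "v \<in> D n" using D by auto
  show "A \<in> sigma_sets \<Omega> (exhaustion_cylinders \<Omega> D)"
  proof (rule determined_in_sigma_algebra[of _ _ "D n" C])
    show "sigma_algebra \<Omega> (sigma_sets \<Omega> (exhaustion_cylinders \<Omega> D))"
      by (rule sigma_algebra_sigma_sets) (rule exhaustion_cylinders_subset)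
    show "cylinder \<Omega> (D n) \<psi> \<in> sigma_sets \<Omega> (exhaustion_cylinders \<Omega> D)" for \<psi>
      by (rule sigma_sets.Basic) (auto simp: exhaustion_cylinders_def)
  qed (use A n C D in auto)
qed

text \<open>Uniqueness of measures on a generating pi-system. The finitely many cylinders over
  \<open>D 0\<close> with patterns in \<open>C\<close> serve as the cover by sets of finite
  mass.\<close>

lemma exhaustion_measure_eqI:
  assumes D: "incseq D" "\<And>n. finite (D n)" "(\<Union>n. D n) = S"
    and C: "finite C" "\<And>\<phi> v. \<phi> \<in> \<Omega> \<Longrightarrow> v \<in> S \<Longrightarrow> \<phi> v \<in> C"
    and M: "finite_measure M" "sets M = sigma_sets \<Omega> (coordinate_events \<Omega> S)"
      "sets N = sigma_sets \<Omega> (coordinate_events \<Omega> S)"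
    and eq: "\<And>n \<psi>. emeasure M (cylinder \<Omega> (D n) \<psi>) = emeasure N (cylinder \<Omega> (D n) \<psi>)"
  shows "M = N"
proof (rule measure_eqI_generator_eq_countable)
  interpret finite_measure M by fact
  have s: "sigma_sets \<Omega> (exhaustion_cylinders \<Omega> D) = sigma_sets \<Omega> (coordinate_events \<Omega> S)"
    by (rule sigma_sets_exhaustion_cylinders[where C = C]) (use D C in auto)
  show "sets M = sigma_sets \<Omega> (exhaustion_cylinders \<Omega> D)" "sets N = sigma_sets \<Omega> (exhaustion_cylinders \<Omega> D)"
    using M s by auto
  let ?A = "(\<lambda>\<psi>. cylinder \<Omega> (D 0) \<psi>) ` PiE (D 0) (\<lambda>_. C)"
  show "?A \<subseteq> exhaustion_cylinders \<Omega> D" by (auto simp: exhaustion_cylinders_def)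
  show "countable ?A"
    by (intro countable_finite finite_imageI finite_PiE) (use D C in auto)
  show "\<Union>?A = \<Omega>"
  proof (intro equalityI subsetI)
    fix \<phi> assume \<phi>: "\<phi> \<in> \<Omega>"
    then have "restrict \<phi> (D 0) \<in> PiE (D 0) (\<lambda>_. C)" using C D by auto
    moreover have "\<phi> \<in> cylinder \<Omega> (D 0) (restrict \<phi> (D 0))" using \<phi> by (simp add: cylinder_def)
    ultimately show "\<phi> \<in> \<Union>?A" by blast
  qed (use cylinder_subset in fastforce)
  show "emeasure M a \<noteq> \<infinity>" for a by simp
  show "emeasure M X = emeasure N X" if "X \<in> exhaustion_cylinders \<Omega> D" for X
    using that eq by (auto simp: exhaustion_cylinders_def)
  show "Int_stable (exhaustion_cylinders \<Omega> D)" by (rule Int_stable_exhaustion_cylinders[OF D(1)])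
  show "exhaustion_cylinders \<Omega> D \<subseteq> Pow \<Omega>" by (rule exhaustion_cylinders_subset)
qed

lemma measure_cylinder_split:
  assumes M: "finite_measure M" and "W \<inter> U = {}" "finite U" "finite C" "\<And>\<phi> v. \<phi> \<in> \<Omega> \<Longrightarrow> v \<in> U \<Longrightarrow> \<phi> v \<in> C"
    and cyl: "\<And>\<eta>. cylinder \<Omega> (W \<union> U) \<eta> \<in> sets M"
  shows "measure M (cylinder \<Omega> W \<psi>) =
    (\<Sum>\<eta>\<in>PiE U (\<lambda>_. C). measure M (cylinder \<Omega> (W \<union> U) (override_on \<psi> \<eta> U)))"
proof -
  have "cylinder \<Omega> W \<psi> = (\<Union>\<eta>\<in>PiE U (\<lambda>_. C). cylinder \<Omega> (W \<union> U) (override_on \<psi> \<eta> U))" (is "?L = ?R")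
  proof (intro equalityI subsetI)
    fix \<phi> assume "\<phi> \<in> ?L"
    then have "restrict \<phi> U \<in> PiE U (\<lambda>_. C)" "\<phi> \<in> cylinder \<Omega> (W \<union> U) (override_on \<psi> (restrict \<phi> U) U)"
      using assms by (auto simp: cylinder_def override_on_def)
    then show "\<phi> \<in> ?R" by blast
  next
    fix \<phi> assume "\<phi> \<in> ?R"
    then show "\<phi> \<in> ?L" using assms(2) by (fastforce simp: cylinder_def override_on_def)
  qed
  moreover have "disjoint_family_on (\<lambda>\<eta>. cylinder \<Omega> (W \<union> U) (override_on \<psi> \<eta> U)) (PiE U (\<lambda>_. C))"
    unfolding disjoint_family_on_def
  proof (intro ballI impI)
    fix \<eta> \<eta>' assume "\<eta> \<in> PiE U (\<lambda>_. C)" "\<eta>' \<in> PiE U (\<lambda>_. C)" "\<eta> \<noteq> \<eta>'"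
    then obtain v where "v \<in> U" "\<eta> v \<noteq> \<eta>' v" by (metis PiE_ext)
    then show "cylinder \<Omega> (W \<union> U) (override_on \<psi> \<eta> U) \<inter> cylinder \<Omega> (W \<union> U) (override_on \<psi> \<eta>' U) = {}"
      by (auto simp: cylinder_def override_on_def)
  qed
  ultimately show ?thesis
    using assms by (simp add: finite_measure.finite_measure_finite_Union finite_PiE image_subset_iff)
qed

lemma measure_cylinder_insert_sum:
  assumes M: "finite_measure M" and "v \<notin> W" "finite C" "\<And>\<phi>. \<phi> \<in> \<Omega> \<Longrightarrow> \<phi> v \<in> C"
    and cyl: "\<And>\<eta>. cylinder \<Omega> (insert v W) \<eta> \<in> sets M"
  shows "measure M (cylinder \<Omega> W \<psi>) = (\<Sum>i\<in>C. measure M (cylinder \<Omega> (insert v W) (\<psi>(v := i))))"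
proof -
  have "cylinder \<Omega> W \<psi> = (\<Union>i\<in>C. cylinder \<Omega> (insert v W) (\<psi>(v := i)))"
  proof (intro equalityI subsetI)
    fix \<phi> assume "\<phi> \<in> cylinder \<Omega> W \<psi>"
    then have "\<phi> \<in> cylinder \<Omega> (insert v W) (\<psi>(v := \<phi> v))" "\<phi> v \<in> C"
      using assms(4) by (auto simp: cylinder_def)
    then show "\<phi> \<in> (\<Union>i\<in>C. cylinder \<Omega> (insert v W) (\<psi>(v := i)))" by blast
  next
    fix \<phi> assume "\<phi> \<in> (\<Union>i\<in>C. cylinder \<Omega> (insert v W) (\<psi>(v := i)))"
    then obtain i where "\<phi> \<in> \<Omega>" "\<forall>u\<in>insert v W. \<phi> u = (\<psi>(v := i)) u" by (auto simp: cylinder_def)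
    then have "\<phi> u = \<psi> u" if "u \<in> W" for u using that assms(2) by (metis fun_upd_other insertI2)
    then show "\<phi> \<in> cylinder \<Omega> W \<psi>" using \<open>\<phi> \<in> \<Omega>\<close> by (simp add: cylinder_def)
  qed
  moreover have *: "\<phi> v = i" if "\<phi> \<in> cylinder \<Omega> (insert v W) (\<psi>(v := i))" for \<phi> i
    using that by (simp add: cylinder_def)
  have "disjoint_family_on (\<lambda>i. cylinder \<Omega> (insert v W) (\<psi>(v := i))) C"
    unfolding disjoint_family_on_def
  proof (intro ballI impI equals0I)
    fix i j \<phi> assume "i \<noteq> j"
      "\<phi> \<in> cylinder \<Omega> (insert v W) (\<psi>(v := i)) \<inter> cylinder \<Omega> (insert v W) (\<psi>(v := j))"
    then show False using * by (metis IntE)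
  qed
  ultimately show ?thesis
    using assms by (simp add: finite_measure.finite_measure_finite_Union image_subset_iff)
qed

text \<open>Over a countable alphabet every condition on one spin is a countable union of point
  conditions. This brings the space of homomorphisms and the product spaces over branches into the
  form in which the sigma-algebra outside a patch is given, so that the same generators serve all
  three.\<close>

lemma sets_restrict_PiM_coordinate:
  assumes "countable C" and \<Omega>: "\<Omega> \<subseteq> PiE S (\<lambda>_. C)"
  shows "sets (restrict_space (PiM S (\<lambda>_. count_space C)) \<Omega>) = sigma_sets \<Omega> (coordinate_events \<Omega> S)"
proof -
  interpret sigma_algebra \<Omega> "sigma_sets \<Omega> (coordinate_events \<Omega> S)"
    by (rule sigma_algebra_sigma_sets) (rule coordinate_events_subset)
  let ?E = "{{f\<in>PiE S (\<lambda>_. C). f i \<in> A} | i A. i \<in> S \<and> A \<in> sets (count_space C)}"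
  have "sets (restrict_space (PiM S (\<lambda>_. count_space C)) \<Omega>) =
      {(\<lambda>x. x) -` A \<inter> \<Omega> | A. A \<in> sigma_sets (PiE S (\<lambda>_. C)) ?E}"
    unfolding sets_restrict_space sets_PiM_single space_count_space by auto
  also have "\<dots> = sigma_sets \<Omega> {A \<inter> \<Omega> | A. A \<in> ?E}"
    by (subst sigma_sets_vimage_commute) (use \<Omega> in auto)
  also have "\<dots> = sigma_sets \<Omega> (coordinate_events \<Omega> S)"
  proof (rule sigma_sets_eqI)
    fix B assume "B \<in> {A \<inter> \<Omega> | A. A \<in> ?E}"
    then obtain i A where B: "B = {f\<in>PiE S (\<lambda>_. C). f i \<in> A} \<inter> \<Omega>" "i \<in> S" "A \<subseteq> C" by auto
    have "B = (\<Union>a\<in>A. {f\<in>\<Omega>. f i = a})" using B \<Omega> by auto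
    moreover have "countable A" using B assms countable_subset by blast
    moreover have "{f\<in>\<Omega>. f i = a} \<in> sigma_sets \<Omega> (coordinate_events \<Omega> S)" for a
      using B by (intro sigma_sets.Basic) (auto simp: coordinate_events_def)
    ultimately show "B \<in> sigma_sets \<Omega> (coordinate_events \<Omega> S)"
      by (simp only:) (rule countable_UN'')
  next
    fix B assume "B \<in> coordinate_events \<Omega> S"
    then obtain v i where B: "B = {\<phi>\<in>\<Omega>. \<phi> v = i}" "v \<in> S" by (auto simp: coordinate_events_def)
    then have 1: "B = {f\<in>PiE S (\<lambda>_. C). f v \<in> {i} \<inter> C} \<inter> \<Omega>" using \<Omega> by auto
    have 2: "{f\<in>PiE S (\<lambda>_. C). f v \<in> {i} \<inter> C} \<in> ?E"
      unfolding mem_Collect_eq using B(2)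
      by (intro exI[of _ v] exI[of _ "{i} \<inter> C"] conjI refl) auto
    show "B \<in> sigma_sets \<Omega> {A \<inter> \<Omega> | A. A \<in> ?E}"
      by (rule sigma_sets.Basic, rule CollectI, rule exI, rule conjI[OF 1 2])
  qed
  finally show ?thesis .
qed

section \<open>Finite subtrees and components\<close>

text \<open>For a single site \<open>A\<close> these are the finite connected sets containing it.
  Only adjacency is used, so the notion survives automorphisms, and its induction rule matches the
  rule for enlarging a cylinder by one site.\<close>

inductive tree_ext :: "('v \<Rightarrow> 'v \<Rightarrow> bool) \<Rightarrow> 'v set \<Rightarrow> 'v set \<Rightarrow> bool" for G A where
  base: "tree_ext G A A"
| step: "tree_ext G A W \<Longrightarrow> u \<in> W \<Longrightarrow> v \<notin> W \<Longrightarrow> G u v \<Longrightarrow> tree_ext G A (insert v W)"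

lemma tree_ext_mono: "tree_ext G A W \<Longrightarrow> A \<subseteq> W"
  by (induction rule: tree_ext.induct) auto

lemma tree_ext_union:
  assumes "tree_ext G A X" "finite Y" "\<And>y. y \<in> Y \<Longrightarrow> \<exists>x\<in>X. G x y"
  shows "tree_ext G A (X \<union> Y)"
  using assms(2,3)
proof (induction Y)
  case empty
  then show ?case using assms(1) by simp
next
  case (insert y Y)
  then obtain x where "x \<in> X" "G x y" by blast
  then show ?case using insert tree_ext.step[of G A "X \<union> Y" x y]
    by (cases "y \<in> X \<union> Y") (auto simp: insert_absorb)
qed

section \<open>The list model of the tree: adjacency, balls and children\<close>

lemma root_site [simp]: "[] \<in> tree_sites r"
  by (simp add: tree_sites_def)

lemma butlast_site: "v \<in> tree_sites r \<Longrightarrow> butlast v \<in> tree_sites r"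
  by (cases v) (auto simp: tree_sites_def dest: in_set_butlastD)

lemma tree_adj_sites: "tree_adj r u v \<Longrightarrow> u \<in> tree_sites r \<and> v \<in> tree_sites r"
  by (simp add: tree_adj_def)

lemma tree_adj_sym: "tree_adj r u v \<Longrightarrow> tree_adj r v u"
  by (auto simp: tree_adj_def)

lemma tree_adj_butlast: "v \<in> tree_sites r \<Longrightarrow> v \<noteq> [] \<Longrightarrow> tree_adj r (butlast v) v"
  by (simp add: tree_adj_def butlast_site)

lemma butlast_neq: "v \<noteq> [] \<Longrightarrow> butlast v \<noteq> v"
  by (metis append_butlast_last_id not_Cons_self2 self_append_conv)

lemma tree_adj_irrefl: "\<not> tree_adj r u u"
  using butlast_neq[of u] by (auto simp: tree_adj_def)

lemma finite_ball: "finite {v \<in> tree_sites r. length v \<le> n}"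
proof (rule finite_subset)
  show "finite {v. set v \<subseteq> {..r} \<and> length v \<le> n}"
    by (rule finite_lists_length_le) simp
  have "set v \<subseteq> {..r}" if "v \<in> tree_sites r" for v
    using that by (cases v) (auto simp: tree_sites_def less_Suc_eq_le intro: less_imp_le)
  then show "{v \<in> tree_sites r. length v \<le> n} \<subseteq> {v. set v \<subseteq> {..r} \<and> length v \<le> n}" by blast
qed

lemma finite_sites_subset_ball:
  assumes "finite U" "U \<subseteq> tree_sites r"
  shows "\<exists>n. U \<subseteq> {v \<in> tree_sites r. length v \<le> n}"
proof -
  have "U \<subseteq> {v \<in> tree_sites r. length v \<le> Max (length ` U)}"
    using assms by auto
  then show ?thesis by blast
qed

lemma tree_adj_length: "tree_adj r u v \<Longrightarrow> length v \<le> Suc (length u)"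
  by (auto simp: tree_adj_def)

lemma finite_neighbours: "finite {v. tree_adj r u v}"
  by (rule finite_subset[OF _ finite_ball[of r "Suc (length u)"]])
    (auto dest: tree_adj_sites tree_adj_length)

lemma card_children:
  assumes "u \<in> tree_sites r"
  shows "card {v \<in> tree_sites r. v \<noteq> [] \<and> butlast v = u} = (if u = [] then Suc r else r)"
proof -
  have "{v \<in> tree_sites r. v \<noteq> [] \<and> butlast v = u} = (\<lambda>j. u @ [j]) ` {..<(if u = [] then Suc r else r)}"
    (is "?L = ?R")
  proof (intro equalityI subsetI)
    fix v assume v: "v \<in> ?L"
    then obtain j where j: "v = u @ [j]" by (metis (mono_tags, lifting) append_butlast_last_id mem_Collect_eq)
    then have "j < (if u = [] then Suc r else r)" using v by (cases u) (auto simp: tree_sites_def)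
    then show "v \<in> ?R" using j by blast
  next
    fix v assume "v \<in> ?R"
    then show "v \<in> ?L" using assms by (cases u) (auto simp: tree_sites_def)
  qed
  then show ?thesis by (simp add: card_image inj_on_def)
qed

text \<open>A finite connected set described by its site \<open>t\<close> nearest the root: the
  parent of every other site stays inside. The law of the walk on such a set has one factor for
  \<open>t\<close> and one transition for each other site.\<close>

definition subtree_top :: "nat \<Rightarrow> nat list set \<Rightarrow> nat list \<Rightarrow> bool" where
  "subtree_top r W t \<longleftrightarrow> finite W \<and> W \<subseteq> tree_sites r \<and> t \<in> W \<and>
     (\<forall>v\<in>W. v \<noteq> t \<longrightarrow> v \<noteq> [] \<and> butlast v \<in> W)"

lemma subtree_top_length:
  assumes "subtree_top r W t" "v \<in> W"
  shows "length t \<le> length v"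
  using assms(2)
proof (induction v rule: length_induct)
  case (1 v)
  show ?case
  proof (cases "v = t")
    case False
    then have v: "v \<noteq> []" "butlast v \<in> W" using assms(1) 1(2) by (auto simp: subtree_top_def)
    then have "length (butlast v) < length v" by simp
    then show ?thesis using 1(1) v(2) by fastforce
  qed simp
qed

lemma subtree_top_parent_notin: "subtree_top r W t \<Longrightarrow> t \<noteq> [] \<Longrightarrow> butlast t \<notin> W"
  using subtree_top_length[of r W t "butlast t"] by (cases t) auto

text \<open>If the new site is the parent of \<open>u\<close>, then the parent of \<open>u\<close>
  lies outside \<open>W\<close>, which only the top allows; the new site becomes the top.\<close>

lemma subtree_top_insert_cases:
  assumes W: "subtree_top r W t" and u: "u \<in> W" "v \<notin> W" "tree_adj r u v"
  obtains (child) "v \<noteq> []" "butlast v = u" "subtree_top r (insert v W) t"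
  | (parent) "t \<noteq> []" "u = t" "v = butlast t" "subtree_top r (insert v W) v"
proof -
  from u(3) consider "v \<noteq> []" "u = butlast v" | "u \<noteq> []" "v = butlast u" by (auto simp: tree_adj_def)
  then show ?thesis
  proof cases
    case 1
    then show ?thesis using W u tree_adj_sites[OF u(3)] by (intro child) (auto simp: subtree_top_def)
  next
    case 2
    then have "u = t" using W u by (auto simp: subtree_top_def)
    then show ?thesis using 2 W u tree_adj_sites[OF u(3)] by (intro parent) (auto simp: subtree_top_def)
  qed
qed

lemma tree_ext_subtree_top:
  assumes "tree_ext (tree_adj r) {x} W" "x \<in> tree_sites r"
  shows "\<exists>t. subtree_top r W t"
  using assms
proof (induction rule: tree_ext.induct)
  case base
  then show ?case by (auto simp: subtree_top_def)
next
  case (step W u v)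
  then obtain t where "subtree_top r W t" by blast
  then show ?case using step by (metis subtree_top_insert_cases)
qed

lemma subtree_top_ball: "subtree_top r {v \<in> tree_sites r. length v \<le> n} []"
  using finite_ball by (auto simp: subtree_top_def butlast_site)

lemma tree_ext_ball: "tree_ext (tree_adj r) {[]} {v \<in> tree_sites r. length v \<le> n}"
proof (induction n)
  case 0
  have "{v \<in> tree_sites r. length v \<le> 0} = {[]}" by auto
  then show ?case by (metis tree_ext.base)
next
  case (Suc n)
  have eq: "{v \<in> tree_sites r. length v \<le> Suc n} =
      {v \<in> tree_sites r. length v \<le> n} \<union> {v \<in> tree_sites r. length v = Suc n}" by auto
  show ?case unfolding eq
  proof (rule tree_ext_union[OF Suc])
    show "finite {v \<in> tree_sites r. length v = Suc n}"
      by (rule finite_subset[OF _ finite_ball[of r "Suc n"]]) auto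
    fix y assume "y \<in> {v \<in> tree_sites r. length v = Suc n}"
    then show "\<exists>x\<in>{v \<in> tree_sites r. length v \<le> n}. tree_adj r x y"
      by (intro bexI[of _ "butlast y"] tree_adj_butlast) (auto simp: butlast_site)
  qed
qed

text \<open>The components of the tree minus \<open>u\<close> are told apart by the first step from \<open>u\<close>
  towards a site.\<close>

definition first_step :: "nat list \<Rightarrow> nat list \<Rightarrow> nat list" where
  "first_step u x = (if take (length u) x = u then take (Suc (length u)) x else butlast u)"

text \<open>Between \<open>butlast x\<close> and \<open>x\<close> the prefix test can change only at
  \<open>x = u\<close>, and when it succeeds the prefix of length \<open>Suc (length u)\<close> can
  change only at \<open>butlast x = u\<close>.\<close>

lemma first_step_butlast:
  assumes "x \<noteq> []" "x \<noteq> u" "butlast x \<noteq> u"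
  shows "first_step u (butlast x) = first_step u x"
proof -
  obtain y a where x: "x = y @ [a]" using assms(1) by (cases x rule: rev_cases) auto
  show ?thesis
  proof (cases "length u \<le> length y")
    case True
    then show ?thesis using assms x
      by (cases "length u = length y") (auto simp: first_step_def)
  next
    case False
    then have "take (length u) x = x" "take (length u) y = y" using x by auto
    moreover have "y \<noteq> u" using False by auto
    ultimately show ?thesis using assms x by (simp add: first_step_def)
  qed
qed

lemma first_step_adj:
  assumes "tree_adj r x y" "x \<noteq> u" "y \<noteq> u"
  shows "first_step u x = first_step u y"
  using assms first_step_butlast[of y u] first_step_butlast[of x u] by (auto simp: tree_adj_def)

lemma first_step_neighbour:
  assumes "tree_adj r u v"
  shows "first_step u v = v"
proof -
  from assms consider "v \<noteq> []" "u = butlast v" | "u \<noteq> []" "v = butlast u" by (auto simp: tree_adj_def)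
  then show ?thesis
  proof cases
    case 1
    then obtain a where "v = u @ [a]" by (metis append_butlast_last_id)
    then show ?thesis by (simp add: first_step_def)
  next
    case 2
    then have "take (length u) v \<noteq> u" using butlast_neq[of u] by auto
    then show ?thesis using 2 by (simp add: first_step_def)
  qed
qed

lemma comp_of_first_step:
  assumes "x \<in> comp_of (tree_adj r) u v" "tree_adj r u v"
  shows "first_step u x = v"
proof -
  have "(\<lambda>a b. tree_adj r a b \<and> a \<noteq> u \<and> b \<noteq> u)\<^sup>*\<^sup>* v x" using assms by (simp add: comp_of_def)
  then show ?thesis
    by (induction rule: rtranclp_induct) (use first_step_neighbour[OF assms(2)] first_step_adj in auto)
qed

lemma comp_of_site:
  assumes "x \<in> comp_of (tree_adj r) u v" "tree_adj r u v"
  shows "x \<in> tree_sites r \<and> x \<noteq> u"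
proof -
  have "(\<lambda>a b. tree_adj r a b \<and> a \<noteq> u \<and> b \<noteq> u)\<^sup>*\<^sup>* v x" using assms by (simp add: comp_of_def)
  then show ?thesis
    by (induction rule: rtranclp_induct) (use assms(2) tree_adj_irrefl tree_adj_sites in \<open>blast+\<close>)
qed

text \<open>Exhausts a component by finite sets. The inequality \<open>k < n\<close> is strict so
  that index 0 gives the empty set, whose cylinder is the whole space; the independence criterion
  asks for that set in the generator.\<close>

definition comp_ball :: "nat \<Rightarrow> nat list \<Rightarrow> nat list \<Rightarrow> nat \<Rightarrow> nat list set" where
  "comp_ball r u v n = {x. \<exists>k<n. ((\<lambda>a b. tree_adj r a b \<and> a \<noteq> u \<and> b \<noteq> u) ^^ k) v x}"

lemma comp_ball_0 [simp]: "comp_ball r u v 0 = {}"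
  by (simp add: comp_ball_def)

lemma incseq_comp_ball: "incseq (comp_ball r u v)"
  unfolding incseq_def comp_ball_def using less_le_trans by blast

lemma Union_comp_ball: "(\<Union>n. comp_ball r u v n) = comp_of (tree_adj r) u v"
proof -
  have "(\<exists>n. \<exists>k<n. (R ^^ k) v x) \<longleftrightarrow> R\<^sup>*\<^sup>* v x" for x and R :: "nat list \<Rightarrow> nat list \<Rightarrow> bool"
    unfolding rtranclp_power by (meson lessI)
  then show ?thesis unfolding comp_of_def comp_ball_def by blast
qed

lemma comp_ball_Suc:
  "comp_ball r u v (Suc (Suc n)) = comp_ball r u v (Suc n) \<union>
     {y. \<exists>x\<in>comp_ball r u v (Suc n). tree_adj r x y \<and> x \<noteq> u \<and> y \<noteq> u}" (is "_ = ?R")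
proof (intro equalityI subsetI)
  let ?S = "\<lambda>a b. tree_adj r a b \<and> a \<noteq> u \<and> b \<noteq> u"
  fix y assume "y \<in> comp_ball r u v (Suc (Suc n))"
  then obtain k where k: "k < Suc (Suc n)" "(?S ^^ k) v y" by (auto simp: comp_ball_def)
  show "y \<in> ?R"
  proof (cases k)
    case 0
    then show ?thesis using k by (auto simp: comp_ball_def)
  next
    case (Suc m)
    then obtain x where "(?S ^^ m) v x" "?S x y" using k(2) by auto
    then show ?thesis using k(1) Suc unfolding comp_ball_def by blast
  qed
next
  let ?S = "\<lambda>a b. tree_adj r a b \<and> a \<noteq> u \<and> b \<noteq> u"
  fix y assume "y \<in> ?R"
  then show "y \<in> comp_ball r u v (Suc (Suc n))"
  proof
    assume "y \<in> comp_ball r u v (Suc n)"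
    then show ?thesis using incseqD[OF incseq_comp_ball, of "Suc n" "Suc (Suc n)"] by auto
  next
    assume "y \<in> {y. \<exists>x\<in>comp_ball r u v (Suc n). ?S x y}"
    then obtain x k where "k < Suc n" "(?S ^^ k) v x" "?S x y" by (auto simp: comp_ball_def)
    then have "Suc k < Suc (Suc n)" "(?S ^^ Suc k) v y" by auto
    then show ?thesis unfolding comp_ball_def by blast
  qed
qed

lemma tree_ext_comp_ball:
  assumes "tree_adj r u v"
  shows "tree_ext (tree_adj r) {u} ({u} \<union> comp_ball r u v n) \<and> finite (comp_ball r u v n)"
proof (induction n)
  case 0
  then show ?case by (auto intro: tree_ext.base)
next
  case (Suc n)
  show ?case
  proof (cases n)
    case 0
    have "comp_ball r u v (Suc 0) = {v}" by (auto simp: comp_ball_def)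
    then show ?thesis using 0 tree_ext_union[OF tree_ext.base, of "{v}" "{u}"] assms by auto
  next
    case (Suc m)
    define Y where "Y = {y. \<exists>x\<in>comp_ball r u v n. tree_adj r x y \<and> x \<noteq> u \<and> y \<noteq> u}"
    have "Y \<subseteq> (\<Union>x\<in>comp_ball r u v n. {y. tree_adj r x y})" unfolding Y_def by auto
    then have "finite Y" using Suc.IH finite_neighbours by (auto intro: finite_subset)
    then show ?thesis
      using Suc.IH tree_ext_union[of "tree_adj r" "{u}" "{u} \<union> comp_ball r u v n" Y]
      unfolding Suc comp_ball_Suc Y_def by (auto simp: Un_assoc)
  qed
qed

section \<open>The law of the walk\<close>

text \<open>The activities are absent: reversibility, invariance and independence of the branches
  concern any positive weights, and the equation linking \<open>w\<close> to \<open>lam\<close>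
  enters with the Gibbs property. Nonempty neighbourhoods make every \<open>z i\<close>
  positive.\<close>

locale weighted_walk =
  fixes r q :: nat and E :: "nat \<Rightarrow> nat \<Rightarrow> bool" and w :: "nat \<Rightarrow> real"
  assumes graph: "constraint_graph q E"
    and nbhd_nonempty: "\<And>i. i \<in> {1..q} \<Longrightarrow> nbhd q E i \<noteq> {}"
    and q_pos: "q \<ge> 1"
    and weight_pos: "\<And>i. i \<in> {1..q} \<Longrightarrow> w i > 0"
begin

abbreviation "V \<equiv> tree_sites r"
abbreviation "G \<equiv> tree_adj r"
abbreviation "z \<equiv> zw q E w"
abbreviation "\<Omega> \<equiv> homs V G q E"

definition total :: real where "total = (\<Sum>i\<in>{1..q}. w i * z i)"

text \<open>Zero outside the node set, as \<open>trans_prob\<close> is zero off the edges, so that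
  product formulas stay true for patterns that no configuration realises.\<close>

definition root_prob :: "nat \<Rightarrow> real" where
  "root_prob j = (if j \<in> {1..q} then w j * z j / total else 0)"

definition trans_prob :: "nat \<Rightarrow> nat \<Rightarrow> real" where
  "trans_prob i j = (if E i j then w j / z i else 0)"

lemma edge_range: "E i j \<Longrightarrow> i \<in> {1..q} \<and> j \<in> {1..q}"
  using graph by (auto simp: constraint_graph_def)

lemma edge_sym: "E i j \<longleftrightarrow> E j i"
  using graph by (auto simp: constraint_graph_def)

lemma nbhd_eq: "nbhd q E i = {j. E i j}"
  using edge_range by (auto simp: nbhd_def)

lemma finite_nbhd: "finite (nbhd q E i)"
  by (simp add: nbhd_def)

lemma z_pos: "i \<in> {1..q} \<Longrightarrow> z i > 0"
  unfolding zw_def using nbhd_nonempty finite_nbhd weight_pos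
  by (intro sum_pos) (auto simp: nbhd_def)

lemma total_pos: "total > 0"
  unfolding total_def using q_pos weight_pos z_pos by (intro sum_pos) auto

lemma root_prob_nonneg: "root_prob j \<ge> 0"
  unfolding root_prob_def using total_pos weight_pos z_pos by (auto simp: less_imp_le)

lemma trans_prob_nonneg: "trans_prob i j \<ge> 0"
  unfolding trans_prob_def using edge_range weight_pos z_pos by (auto simp: less_imp_le)

lemma sum_root_prob: "(\<Sum>j\<in>{1..q}. root_prob j) = 1"
  using total_pos unfolding root_prob_def total_def by (simp flip: sum_divide_distrib)

lemma sum_trans_prob:
  assumes "i \<in> {1..q}"
  shows "(\<Sum>j\<in>nbhd q E i. trans_prob i j) = 1"
proof -
  have "(\<Sum>j\<in>nbhd q E i. trans_prob i j) = (\<Sum>j\<in>nbhd q E i. w j / z i)"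
    by (intro sum.cong) (auto simp: trans_prob_def nbhd_eq)
  also have "\<dots> = 1" using z_pos[OF assms] by (simp add: zw_def flip: sum_divide_distrib)
  finally show ?thesis .
qed

text \<open>Along an edge both sides are \<open>w i * w j / total\<close>: the factor
  \<open>z i\<close> in the root law cancels the denominator of the transition.\<close>

lemma detailed_balance: "root_prob i * trans_prob i j = root_prob j * trans_prob j i"
proof (cases "E i j")
  case True
  then have "E j i" "i \<in> {1..q}" "j \<in> {1..q}" using edge_sym edge_range by auto
  then show ?thesis using True z_pos[of i] z_pos[of j] by (simp add: root_prob_def trans_prob_def)
next
  case False
  then show ?thesis using edge_sym by (simp add: trans_prob_def)
qed

text \<open>The walk is a function of independent choices, one for every site and every possible spin
  of its parent; the fictitious parent spin 0 stands for the start at the root.\<close>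

definition spins :: "nat \<Rightarrow> nat set" where
  "spins i = (if i \<in> {1..q} then nbhd q E i else {1..q})"

definition step_prob :: "nat \<Rightarrow> nat \<Rightarrow> real" where
  "step_prob i j = (if i \<in> {1..q} then trans_prob i j else root_prob j)"

definition spin_law :: "nat \<Rightarrow> nat measure" where
  "spin_law i = point_measure (spins i) (\<lambda>j. ennreal (step_prob i j))"

lemma step_prob_nonneg: "step_prob i j \<ge> 0"
  by (simp add: step_prob_def trans_prob_nonneg root_prob_nonneg)

lemma finite_spins: "finite (spins i)"
  by (simp add: spins_def finite_nbhd)

lemma spins_subset: "spins i \<subseteq> {1..q}"
  by (auto simp: spins_def nbhd_def)

lemma space_spin_law: "space (spin_law i) = spins i"
  by (simp add: spin_law_def space_point_measure)

lemma sets_spin_law: "sets (spin_law i) = Pow (spins i)"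
  by (simp add: spin_law_def sets_point_measure)

lemma prob_space_spin_law: "prob_space (spin_law i)"
proof (rule prob_spaceI)
  have "emeasure (spin_law i) (spins i) = ennreal (\<Sum>j\<in>spins i. step_prob i j)"
    unfolding spin_law_def by (simp add: emeasure_point_measure_finite finite_spins sum_ennreal step_prob_nonneg)
  also have "(\<Sum>j\<in>spins i. step_prob i j) = 1"
    by (cases "i \<in> {1..q}")
      (simp_all only: spins_def step_prob_def if_True if_False sum_root_prob sum_trans_prob)
  finally show "emeasure (spin_law i) (space (spin_law i)) = 1" by (simp add: space_spin_law)
qed

lemma emeasure_spin_law_singleton: "emeasure (spin_law i) ({j} \<inter> spins i) = ennreal (step_prob i j)"
proof (cases "j \<in> spins i")
  case True
  then show ?thesis unfolding spin_law_def by (simp add: emeasure_point_measure_finite finite_spins)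
next
  case False
  then have "step_prob i j = 0"
    by (auto simp: spins_def step_prob_def trans_prob_def root_prob_def nbhd_eq split: if_splits)
  then show ?thesis using False by simp
qed

text \<open>The coordinates for parent spins that do not occur are drawn as well; a realisation of
  the walk reads exactly one coordinate per site.\<close>

definition noise :: "(nat list \<times> nat \<Rightarrow> nat) measure" where
  "noise = PiM UNIV (\<lambda>x. spin_law (snd x))"

lemma space_noise: "f \<in> space noise \<Longrightarrow> f x \<in> spins (snd x)"
  by (cases x) (auto simp: noise_def space_PiM PiE_iff space_spin_law)

end

function walk_spin :: "(nat list \<times> nat \<Rightarrow> nat) \<Rightarrow> nat list \<Rightarrow> nat" where
  "walk_spin f v = f (v, if v = [] then 0 else walk_spin f (butlast v))"
  by auto
termination
  by (relation "Wellfounded.measure (\<lambda>(f, v). length v)") auto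

declare walk_spin.simps [simp del]

context weighted_walk
begin

definition walk_measure :: "(nat list \<Rightarrow> nat) measure" where
  "walk_measure = distr noise (hom_space V G q E) (\<lambda>f. restrict (walk_spin f) V)"

lemma walk_spin_range:
  assumes "f \<in> space noise"
  shows "walk_spin f v \<in> {1..q}"
  using space_noise[OF assms] spins_subset by (subst walk_spin.simps) blast

lemma walk_spin_edge:
  assumes "f \<in> space noise" "v \<noteq> []"
  shows "E (walk_spin f (butlast v)) (walk_spin f v)"
proof -
  have "walk_spin f v \<in> spins (walk_spin f (butlast v))"
    using space_noise[OF assms(1)] assms(2) by (subst walk_spin.simps) auto
  then show ?thesis using walk_spin_range[OF assms(1)] by (simp add: spins_def nbhd_eq)
qed

lemma walk_in_homs:
  assumes "f \<in> space noise"
  shows "restrict (walk_spin f) V \<in> \<Omega>"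
  using walk_spin_range[OF assms] walk_spin_edge[OF assms] edge_sym
  by (auto simp: homs_def tree_adj_def)

lemma measurable_walk_spin: "(\<lambda>f. walk_spin f v) \<in> measurable noise (count_space {1..q})"
proof (induction v rule: length_induct)
  case (1 v)
  have m: "(\<lambda>f. f (v, i)) \<in> measurable noise (count_space {1..q})" for i
  proof -
    have "(\<lambda>f. f (v, i)) \<in> measurable noise (spin_law i)"
      unfolding noise_def using measurable_component_singleton[of "(v, i)" UNIV "\<lambda>x. spin_law (snd x)"] by simp
    moreover have "(\<lambda>j. j) \<in> measurable (spin_law i) (count_space {1..q})"
      unfolding spin_law_def using spins_subset by (subst measurable_point_measure_eq1) auto
    ultimately show ?thesis by (rule measurable_compose)
  qed
  show ?case
  proof (cases "v = []")
    case True
    then show ?thesis using m by (subst walk_spin.simps) simp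
  next
    case False
    then have "(\<lambda>f. walk_spin f (butlast v)) \<in> measurable noise (count_space {1..q})" using 1 by simp
    \<comment> \<open>The coordinate read at \<open>v\<close> has a random index, but one with
      countably many values.\<close>
    with m have "(\<lambda>f. f (v, walk_spin f (butlast v))) \<in> measurable noise (count_space {1..q})"
      by (rule measurable_compose_countable') auto
    then show ?thesis using False by (subst walk_spin.simps) simp
  qed
qed

lemma measurable_walk: "(\<lambda>f. restrict (walk_spin f) V) \<in> measurable noise (hom_space V G q E)"
  unfolding hom_space_def
proof (rule measurable_restrict_space2)
  show "(\<lambda>f. restrict (walk_spin f) V) \<in> space noise \<rightarrow> \<Omega>" using walk_in_homs by blast
  show "(\<lambda>f. restrict (walk_spin f) V) \<in> measurable noise (PiM V (\<lambda>_. count_space {1..q}))"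
    by (rule measurable_restrict) (rule measurable_walk_spin)
qed

lemma homs_subset: "\<Omega> \<subseteq> PiE V (\<lambda>_. {1..q})"
  by (auto simp: homs_def)

lemma homs_range: "\<phi> \<in> \<Omega> \<Longrightarrow> v \<in> V \<Longrightarrow> \<phi> v \<in> {1..q}"
  using homs_subset by blast

lemma space_hom_space: "space (hom_space V G q E) = \<Omega>"
  using homs_subset by (auto simp: hom_space_def space_restrict_space space_PiM)

lemma sets_hom_space: "sets (hom_space V G q E) = sigma_sets \<Omega> (coordinate_events \<Omega> V)"
  unfolding hom_space_def by (rule sets_restrict_PiM_coordinate) (use homs_subset in auto)

lemma space_walk_measure [simp]: "space walk_measure = \<Omega>"
  by (simp add: walk_measure_def space_hom_space)

lemma sets_walk_measure: "sets walk_measure = sigma_sets \<Omega> (coordinate_events \<Omega> V)"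
  by (simp add: walk_measure_def sets_hom_space)

lemma prob_space_noise: "prob_space noise"
  unfolding noise_def by (rule prob_space_PiM) (rule prob_space_spin_law)

sublocale walk: prob_space walk_measure
  unfolding walk_measure_def by (rule prob_space.prob_space_distr[OF prob_space_noise measurable_walk])

section \<open>Probabilities of cylinders over finite subtrees\<close>

lemma cylinder_measurable:
  "finite W \<Longrightarrow> W \<subseteq> V \<Longrightarrow> cylinder \<Omega> W \<psi> \<in> sets walk_measure"
  unfolding sets_walk_measure by (rule cylinder_in_coordinate_algebra)

text \<open>Once the pattern is prescribed, the coordinate read at \<open>v\<close> is known in
  advance, namely \<open>(v, par v)\<close>. The event becomes a finite product event in the noise,
  with distinct coordinates for distinct sites.\<close>

lemma prob_cylinder_root:
  assumes W: "subtree_top r W []"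
  shows "walk.prob (cylinder \<Omega> W \<psi>) = (\<Prod>v\<in>W. step_prob (if v = [] then 0 else \<psi> (butlast v)) (\<psi> v))"
proof -
  interpret N: product_prob_space "\<lambda>x::nat list \<times> nat. spin_law (snd x)" UNIV
    by (rule product_prob_spaceI) (rule prob_space_spin_law)
  define par where "par = (\<lambda>v. if v = [] then 0 else \<psi> (butlast v))"
  define J where "J = (\<lambda>v. (v, par v)) ` W"
  have fin: "finite W" and WV: "W \<subseteq> V" and cl: "\<And>v. v \<in> W \<Longrightarrow> v \<noteq> [] \<Longrightarrow> butlast v \<in> W"
    using W by (auto simp: subtree_top_def)
  have inj: "inj_on (\<lambda>v. (v, par v)) W" by (auto simp: inj_on_def)
  \<comment> \<open>A prescribed spin may lie outside the alphabet of its coordinate; intersecting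
    with \<open>spins\<close> turns this case into the empty set, which is measurable.\<close>
  have iff: "(\<forall>v\<in>W. walk_spin f v = \<psi> v) \<longleftrightarrow> (\<forall>x\<in>J. f x \<in> {\<psi> (fst x)} \<inter> spins (snd x))"
    if f: "f \<in> space noise" for f
  proof
    assume *: "\<forall>v\<in>W. walk_spin f v = \<psi> v"
    show "\<forall>x\<in>J. f x \<in> {\<psi> (fst x)} \<inter> spins (snd x)"
    proof
      fix x assume "x \<in> J"
      then obtain v where v: "v \<in> W" "x = (v, par v)" by (auto simp: J_def)
      then have "f x = \<psi> v" using * cl[OF v(1)] walk_spin.simps[of f v] by (auto simp: par_def)
      then show "f x \<in> {\<psi> (fst x)} \<inter> spins (snd x)" using space_noise[OF f, of x] v by simp
    qed
  next
    assume *: "\<forall>x\<in>J. f x \<in> {\<psi> (fst x)} \<inter> spins (snd x)"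
    have "v \<in> W \<longrightarrow> walk_spin f v = \<psi> v" for v
    proof (induction v rule: length_induct)
      case (1 v)
      show ?case
      proof
        assume v: "v \<in> W"
        then have "walk_spin f (butlast v) = \<psi> (butlast v)" if "v \<noteq> []"
          using 1 cl that by simp
        then have "walk_spin f v = f (v, par v)" by (subst walk_spin.simps) (simp add: par_def)
        also have "\<dots> = \<psi> v" using * v by (auto simp: J_def)
        finally show "walk_spin f v = \<psi> v" .
      qed
    qed
    then show "\<forall>v\<in>W. walk_spin f v = \<psi> v" by blast
  qed
  have "emeasure walk_measure (cylinder \<Omega> W \<psi>) =
      emeasure noise ((\<lambda>f. restrict (walk_spin f) V) -` cylinder \<Omega> W \<psi> \<inter> space noise)"
    unfolding walk_measure_def
    by (rule emeasure_distr[OF measurable_walk])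
      (use cylinder_measurable[OF fin WV] in \<open>simp add: walk_measure_def\<close>)
  also have "(\<lambda>f. restrict (walk_spin f) V) -` cylinder \<Omega> W \<psi> \<inter> space noise =
      {f \<in> space noise. \<forall>v\<in>W. walk_spin f v = \<psi> v}"
    using walk_in_homs WV by (auto simp: cylinder_def subset_iff)
  also have "\<dots> = {f \<in> space noise. \<forall>x\<in>J. f x \<in> {\<psi> (fst x)} \<inter> spins (snd x)}"
    using iff by blast
  also have "emeasure noise \<dots> = (\<Prod>x\<in>J. emeasure (spin_law (snd x)) ({\<psi> (fst x)} \<inter> spins (snd x)))"
    unfolding noise_def by (rule N.emeasure_PiM_Collect) (use fin in \<open>auto simp: J_def sets_spin_law\<close>)
  also have "\<dots> = (\<Prod>v\<in>W. ennreal (step_prob (par v) (\<psi> v)))"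
    unfolding J_def prod.reindex[OF inj] by (simp only: o_def emeasure_spin_law_singleton fst_conv snd_conv)
  also have "\<dots> = ennreal (\<Prod>v\<in>W. step_prob (par v) (\<psi> v))"
    by (rule prod_ennreal) (rule step_prob_nonneg)
  finally show ?thesis
    unfolding measure_def par_def by (simp add: prod_nonneg step_prob_nonneg)
qed

text \<open>By detailed balance the law can be started from any site, not only from the root.\<close>

lemma prob_cylinder_top:
  assumes "subtree_top r W t"
  shows "walk.prob (cylinder \<Omega> W \<psi>) = root_prob (\<psi> t) * (\<Prod>v\<in>W - {t}. trans_prob (\<psi> (butlast v)) (\<psi> v))"
  using assms
proof (induction t arbitrary: W \<psi> rule: length_induct)
  case (1 t)
  have W: "finite W" "W \<subseteq> V" "t \<in> W" and cl: "\<And>v. v \<in> W \<Longrightarrow> v \<noteq> t \<Longrightarrow> v \<noteq> [] \<and> butlast v \<in> W"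
    using 1(2) by (auto simp: subtree_top_def)
  show ?case
  proof (cases "\<forall>v\<in>W. \<psi> v \<in> {1..q}")
    case False
    then obtain v where v: "v \<in> W" "\<psi> v \<notin> {1..q}" by blast
    then have "cylinder \<Omega> W \<psi> = {}" using homs_range W by (fastforce simp: cylinder_def)
    moreover have "root_prob (\<psi> t) * (\<Prod>v\<in>W - {t}. trans_prob (\<psi> (butlast v)) (\<psi> v)) = 0"
    proof (cases "v = t")
      case True
      then show ?thesis using v by (auto simp: root_prob_def)
    next
      case False
      then have "\<exists>v\<in>W - {t}. trans_prob (\<psi> (butlast v)) (\<psi> v) = 0"
        using v edge_range by (intro bexI[of _ v]) (auto simp: trans_prob_def)
      then have "(\<Prod>v\<in>W - {t}. trans_prob (\<psi> (butlast v)) (\<psi> v)) = 0" using W by (intro prod_zero) auto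
      then show ?thesis by simp
    qed
    ultimately show ?thesis by simp
  next
    case valid: True
    show ?thesis
    proof (cases "t = []")
      case True
      have "walk.prob (cylinder \<Omega> W \<psi>) = (\<Prod>v\<in>W. step_prob (if v = [] then 0 else \<psi> (butlast v)) (\<psi> v))"
        using 1(2) True by (intro prob_cylinder_root) simp
      also have "\<dots> = step_prob 0 (\<psi> []) *
          (\<Prod>v\<in>W - {[]}. step_prob (if v = [] then 0 else \<psi> (butlast v)) (\<psi> v))"
        using W True by (subst prod.remove[of W "[]"]) auto
      also have "(\<Prod>v\<in>W - {[]}. step_prob (if v = [] then 0 else \<psi> (butlast v)) (\<psi> v)) =
          (\<Prod>v\<in>W - {[]}. trans_prob (\<psi> (butlast v)) (\<psi> v))"
      proof (rule prod.cong)
        fix v assume "v \<in> W - {[]}"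
        then have "v \<noteq> []" "\<psi> (butlast v) \<in> {1..q}" using cl[of v] valid True by auto
        then show "step_prob (if v = [] then 0 else \<psi> (butlast v)) (\<psi> v) = trans_prob (\<psi> (butlast v)) (\<psi> v)"
          by (simp add: step_prob_def)
      qed simp
      finally show ?thesis using True by (simp add: step_prob_def)
    next
      case False
      \<comment> \<open>The parent \<open>p\<close> of the top is added and its spin summed out. The
        induction hypothesis applies to the larger set because \<open>p\<close> is closer to the
        root; detailed balance moves the root law from \<open>p\<close> to \<open>t\<close>, and the
        remaining transition probabilities sum to 1.\<close>
      define p where "p = butlast t"
      define W' where "W' = insert p W"
      have pW: "p \<notin> W" unfolding p_def by (rule subtree_top_parent_notin[OF 1(2) False])
      have pV: "p \<in> V" unfolding p_def using W butlast_site by blast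
      have top: "subtree_top r W' p"
        using cl W pV unfolding subtree_top_def W'_def p_def using False by auto
      have len: "length p < length t" using False by (simp add: p_def)
      have tp: "t \<noteq> p" using pW W by blast
      have *: "walk.prob (cylinder \<Omega> W' (\<psi>(p := i))) =
          root_prob i * trans_prob i (\<psi> t) * (\<Prod>v\<in>W - {t}. trans_prob (\<psi> (butlast v)) (\<psi> v))" for i
      proof -
        have "walk.prob (cylinder \<Omega> W' (\<psi>(p := i))) = root_prob i *
            (\<Prod>v\<in>W. trans_prob ((\<psi>(p := i)) (butlast v)) ((\<psi>(p := i)) v))"
          using 1(1) len top pW by (simp add: W'_def)
        also have "(\<Prod>v\<in>W. trans_prob ((\<psi>(p := i)) (butlast v)) ((\<psi>(p := i)) v)) =
            trans_prob i (\<psi> t) * (\<Prod>v\<in>W - {t}. trans_prob ((\<psi>(p := i)) (butlast v)) ((\<psi>(p := i)) v))"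
          using W tp by (subst prod.remove[of W t]) (auto simp: p_def)
        also have "(\<Prod>v\<in>W - {t}. trans_prob ((\<psi>(p := i)) (butlast v)) ((\<psi>(p := i)) v)) =
            (\<Prod>v\<in>W - {t}. trans_prob (\<psi> (butlast v)) (\<psi> v))"
          using cl pW by (intro prod.cong) (auto simp: fun_upd_def)
        finally show ?thesis by (simp only: mult.assoc)
      qed
      have "walk.prob (cylinder \<Omega> W \<psi>) = (\<Sum>i\<in>{1..q}. walk.prob (cylinder \<Omega> W' (\<psi>(p := i))))"
        unfolding W'_def
        by (rule measure_cylinder_insert_sum[OF walk.finite_measure_axioms pW])
          (use homs_range pV cylinder_measurable W in auto)
      also have "\<dots> = (\<Sum>i\<in>{1..q}. root_prob i * trans_prob i (\<psi> t)) *
          (\<Prod>v\<in>W - {t}. trans_prob (\<psi> (butlast v)) (\<psi> v))"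
        unfolding * sum_distrib_right ..
      also have "(\<Sum>i\<in>{1..q}. root_prob i * trans_prob i (\<psi> t)) =
          root_prob (\<psi> t) * (\<Sum>i\<in>{1..q}. trans_prob (\<psi> t) i)"
        unfolding sum_distrib_left by (intro sum.cong refl detailed_balance)
      also have "(\<Sum>i\<in>{1..q}. trans_prob (\<psi> t) i) = (\<Sum>i\<in>nbhd q E (\<psi> t). trans_prob (\<psi> t) i)"
        by (rule sum.mono_neutral_right) (auto simp: nbhd_def trans_prob_def)
      also have "\<dots> = 1" using valid W by (intro sum_trans_prob) auto
      finally show ?thesis by simp
    qed
  qed
qed

lemma prob_cylinder_insert:
  assumes W: "subtree_top r W t" and uv: "u \<in> W" "v \<notin> W" "G u v"
  shows "walk.prob (cylinder \<Omega> (insert v W) \<psi>) = walk.prob (cylinder \<Omega> W \<psi>) * trans_prob (\<psi> u) (\<psi> v)"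
proof -
  have fin: "finite W" "t \<in> W" using W by (auto simp: subtree_top_def)
  show ?thesis
    using W uv
  proof (cases rule: subtree_top_insert_cases)
    case child
    have "insert v W - {t} = insert v (W - {t})" using fin uv by auto
    then show ?thesis
      unfolding prob_cylinder_top[OF W] prob_cylinder_top[OF child(3)] using fin uv child by simp
  next
    \<comment> \<open>The product for the larger set starts at \<open>v\<close> and contains the
      transition down to the old top \<open>t\<close>; detailed balance turns this transition
      round.\<close>
    case parent
    have "insert v W - {v} = W" using uv by auto
    moreover have "(\<Prod>v\<in>W. trans_prob (\<psi> (butlast v)) (\<psi> v)) =
        trans_prob (\<psi> v) (\<psi> t) * (\<Prod>v\<in>W - {t}. trans_prob (\<psi> (butlast v)) (\<psi> v))"
      using fin parent by (subst prod.remove[of W t]) auto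
    ultimately show ?thesis
      unfolding prob_cylinder_top[OF W] prob_cylinder_top[OF parent(4)]
      using detailed_balance[of "\<psi> v" "\<psi> t"] parent by simp
  qed
qed

lemma prob_cylinder_singleton:
  assumes "v \<in> V"
  shows "walk.prob (cylinder \<Omega> {v} \<psi>) = root_prob (\<psi> v)"
proof -
  have "subtree_top r {v} v" using assms by (simp add: subtree_top_def)
  from prob_cylinder_top[OF this] show ?thesis by simp
qed

lemma walk_law_walk_measure: "walk_law r q E w walk_measure"
  unfolding walk_law_def
proof (intro conjI allI impI)
  show "prob_space walk_measure" by (rule walk.prob_space_axioms)
  show "sets walk_measure = sets (hom_space V G q E)" by (simp add: walk_measure_def)
  fix n and \<psi> :: "nat list \<Rightarrow> nat"
  assume \<psi>: "\<forall>v\<in>V. length v \<le> n \<longrightarrow> \<psi> v \<in> {1..q}"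
  let ?B = "{v \<in> V. length v \<le> n}"
  have "walk.prob {\<phi> \<in> space walk_measure. \<forall>v\<in>V. length v \<le> n \<longrightarrow> \<phi> v = \<psi> v} = walk.prob (cylinder \<Omega> ?B \<psi>)"
    by (rule arg_cong[of _ _ walk.prob]) (auto simp: cylinder_def)
  also have "\<dots> = root_prob (\<psi> []) * (\<Prod>v\<in>?B - {[]}. trans_prob (\<psi> (butlast v)) (\<psi> v))"
    by (rule prob_cylinder_top[OF subtree_top_ball])
  also have "?B - {[]} = {v \<in> V. length v \<le> n \<and> v \<noteq> []}" by auto
  also have "root_prob (\<psi> []) = w (\<psi> []) * z (\<psi> []) / (\<Sum>i\<in>{1..q}. w i * z i)"
    using \<psi>[rule_format, of "[]"] by (simp add: root_prob_def total_def)
  finally show "walk.prob {\<phi> \<in> space walk_measure. \<forall>v\<in>V. length v \<le> n \<longrightarrow> \<phi> v = \<psi> v} =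
      w (\<psi> []) * z (\<psi> []) / (\<Sum>i\<in>{1..q}. w i * z i) *
      (\<Prod>v\<in>{v \<in> V. length v \<le> n \<and> v \<noteq> []}.
        if \<psi> v \<in> nbhd q E (\<psi> (butlast v)) then w (\<psi> v) / z (\<psi> (butlast v)) else 0)"
    unfolding trans_prob_def nbhd_eq by simp
qed

end

section \<open>Invariance\<close>

context weighted_walk
begin

text \<open>Induction along the growth of \<open>W\<close>. Single sites all have the law
  \<open>root_prob\<close>, and each further site contributes a transition along an edge, which
  \<open>\<alpha>\<close> maps to an edge even where it reverses which end is the parent.\<close>

lemma prob_cylinder_automorphism:
  assumes aut: "board_aut V G \<alpha>" and W: "tree_ext G {[]} W"
  shows "tree_ext G {\<alpha> []} (\<alpha> ` W) \<and> W \<subseteq> V \<and>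
    walk.prob (cylinder \<Omega> (\<alpha> ` W) (\<psi> \<circ> inv_into V \<alpha>)) = walk.prob (cylinder \<Omega> W \<psi>)"
  using W
proof (induction rule: tree_ext.induct)
  have bij: "bij_betw \<alpha> V V" using aut by (simp add: board_aut_def)
  case base
  have "\<alpha> [] \<in> V" using bij_betwE[OF bij] by simp
  moreover have "inv_into V \<alpha> (\<alpha> []) = []" using bij by (simp add: bij_betw_def inv_into_f_f)
  ultimately show ?case
    using prob_cylinder_singleton[of "\<alpha> []"] prob_cylinder_singleton[of "[]"] by (auto intro: tree_ext.base)
next
  case (step W u v)
  have bij: "bij_betw \<alpha> V V" using aut by (simp add: board_aut_def)
  have root: "\<alpha> [] \<in> V" using bij_betwE[OF bij] by simp
  have uv: "u \<in> V" "v \<in> V" using tree_adj_sites[OF step.hyps(4)] by auto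
  have inv: "inv_into V \<alpha> (\<alpha> x) = x" if "x \<in> V" for x
    using bij that by (simp add: bij_betw_def inv_into_f_f)
  have notin: "\<alpha> v \<notin> \<alpha> ` W" using inv uv step.IH step.hyps(3) by (metis imageE subsetD)
  have adj: "G (\<alpha> u) (\<alpha> v)" using aut uv step.hyps(4) unfolding board_aut_def by blast
  obtain s t where s: "subtree_top r W s" and t: "subtree_top r (\<alpha> ` W) t"
    using tree_ext_subtree_top[OF step.hyps(1)] tree_ext_subtree_top[OF conjunct1[OF step.IH]] root by auto
  have "walk.prob (cylinder \<Omega> (insert (\<alpha> v) (\<alpha> ` W)) (\<psi> \<circ> inv_into V \<alpha>)) =
      walk.prob (cylinder \<Omega> (\<alpha> ` W) (\<psi> \<circ> inv_into V \<alpha>)) * trans_prob (\<psi> u) (\<psi> v)"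
    using prob_cylinder_insert[OF t _ notin adj, of "\<psi> \<circ> inv_into V \<alpha>"] step.hyps(2) inv uv by simp
  also have "\<dots> = walk.prob (cylinder \<Omega> (insert v W) \<psi>)"
    by (simp only: step.IH prob_cylinder_insert[OF s step.hyps(2-4)])
  finally have "walk.prob (cylinder \<Omega> (\<alpha> ` insert v W) (\<psi> \<circ> inv_into V \<alpha>)) = walk.prob (cylinder \<Omega> (insert v W) \<psi>)"
    by (simp only: image_insert)
  moreover have "tree_ext G {\<alpha> []} (\<alpha> ` insert v W)"
    using tree_ext.step[OF conjunct1[OF step.IH] _ notin adj] step.hyps(2) by simp
  moreover have "insert v W \<subseteq> V" using step.IH uv by simp
  ultimately show ?case by blast
qed

lemma invariant_walk_measure: "invariant_meas V G q E walk_measure"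
  unfolding invariant_meas_def
proof (intro allI impI)
  fix \<alpha> assume aut: "board_aut V G \<alpha>"
  define T where "T = (\<lambda>\<phi> :: nat list \<Rightarrow> nat. restrict (\<phi> \<circ> \<alpha>) V)"
  have bij: "bij_betw \<alpha> V V" using aut by (simp add: board_aut_def)
  have \<alpha>V: "\<alpha> v \<in> V" if "v \<in> V" for v using bij_betwE[OF bij] that by blast
  have T: "T \<phi> \<in> \<Omega>" if "\<phi> \<in> \<Omega>" for \<phi>
  proof -
    have adj: "G (\<alpha> u) (\<alpha> v)" if "u \<in> V" "v \<in> V" "G u v" for u v
      using aut that unfolding board_aut_def by blast
    have "\<phi> (\<alpha> v) \<in> {1..q}" if "v \<in> V" for v using homs_range \<open>\<phi> \<in> \<Omega>\<close> \<alpha>V that by blast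
    moreover have "E (\<phi> (\<alpha> u)) (\<phi> (\<alpha> v))" if "u \<in> V" "v \<in> V" "G u v" for u v
      using \<open>\<phi> \<in> \<Omega>\<close> adj[OF that] \<alpha>V that unfolding homs_def by blast
    ultimately show ?thesis unfolding homs_def T_def by (auto simp: PiE_iff)
  qed
  have meas: "T \<in> measurable walk_measure (hom_space V G q E)"
  proof (rule measurable_sigma_sets[OF sets_hom_space coordinate_events_subset])
    show "T \<in> space walk_measure \<rightarrow> \<Omega>" using T by simp
    fix A assume "A \<in> coordinate_events \<Omega> V"
    then obtain v i where A: "A = {\<phi>\<in>\<Omega>. \<phi> v = i}" "v \<in> V" by (auto simp: coordinate_events_def)
    have "T -` A \<inter> space walk_measure = cylinder \<Omega> {\<alpha> v} (\<lambda>_. i)"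
    proof (intro set_eqI)
      have "T \<phi> v = \<phi> (\<alpha> v)" for \<phi> using A(2) by (simp add: T_def)
      then show "\<phi> \<in> T -` A \<inter> space walk_measure \<longleftrightarrow> \<phi> \<in> cylinder \<Omega> {\<alpha> v} (\<lambda>_. i)" for \<phi>
        using T[of \<phi>] unfolding A(1) cylinder_def by auto
    qed
    then show "T -` A \<inter> space walk_measure \<in> sets walk_measure"
      using cylinder_measurable[of "{\<alpha> v}"] \<alpha>V A by simp
  qed
  let ?D = "\<lambda>n. {v \<in> V. length v \<le> n}"
  have "distr walk_measure (hom_space V G q E) T = walk_measure"
  proof (rule exhaustion_measure_eqI[where D = ?D and S = V and C = "{1..q}" and \<Omega> = \<Omega>])
    show "incseq ?D" by (auto simp: incseq_def)
    show "finite_measure (distr walk_measure (hom_space V G q E) T)"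
      using walk.prob_space_distr[OF meas] prob_space.finite_measure by blast
    show "finite (?D n)" for n by (rule finite_ball)
    fix n \<psi>
    have W: "tree_ext G {[]} (?D n)" by (rule tree_ext_ball)
    have "emeasure (distr walk_measure (hom_space V G q E) T) (cylinder \<Omega> (?D n) \<psi>) =
        emeasure walk_measure (T -` cylinder \<Omega> (?D n) \<psi> \<inter> space walk_measure)"
      using meas by (rule emeasure_distr)
        (use cylinder_measurable[OF finite_ball] in \<open>auto simp: walk_measure_def\<close>)
    \<comment> \<open>Precomposition with \<open>\<alpha>\<close> reads the spins at the sites of
      the image ball, so the preimage is a cylinder over that image.\<close>
    also have "T -` cylinder \<Omega> (?D n) \<psi> \<inter> space walk_measure =
        cylinder \<Omega> (\<alpha> ` ?D n) (\<psi> \<circ> inv_into V \<alpha>)"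
    proof -
      have "inv_into V \<alpha> (\<alpha> x) = x" "T \<phi> x = \<phi> (\<alpha> x)" if "x \<in> V" for x \<phi>
        using bij that by (simp_all add: bij_betw_def inv_into_f_f T_def)
      then have "T \<phi> \<in> cylinder \<Omega> (?D n) \<psi> \<longleftrightarrow> \<phi> \<in> cylinder \<Omega> (\<alpha> ` ?D n) (\<psi> \<circ> inv_into V \<alpha>)"
        if "\<phi> \<in> \<Omega>" for \<phi>
        using T[OF that] that by (simp add: cylinder_def)
      then show ?thesis using cylinder_subset by fastforce
    qed
    finally show "emeasure (distr walk_measure (hom_space V G q E) T) (cylinder \<Omega> (?D n) \<psi>) =
        emeasure walk_measure (cylinder \<Omega> (?D n) \<psi>)"
      using prob_cylinder_automorphism[OF aut W, of \<psi>] by (simp add: walk.emeasure_eq_measure)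
  qed (use homs_range sets_hom_space sets_walk_measure in auto)
  then show "distr walk_measure (hom_space V G q E) (\<lambda>\<phi>. restrict (\<phi> \<circ> \<alpha>) V) = walk_measure"
    by (simp add: T_def)
qed

end

section \<open>Independence of the branches\<close>

lemma sets_PiM_coordinate:
  assumes "countable C"
  shows "sets (PiM S (\<lambda>_. count_space C)) = sigma_sets (PiE S (\<lambda>_. C)) (coordinate_events (PiE S (\<lambda>_. C)) S)"
proof -
  let ?M = "PiM S (\<lambda>_. count_space C)"
  have "sets (restrict_space ?M (space ?M)) = (\<lambda>A. A) ` sets ?M"
    unfolding sets_restrict_space by (rule image_cong[OF refl]) (rule sets.Int_space_eq1)
  moreover have "space ?M = PiE S (\<lambda>_. C)" by (simp add: space_PiM)
  ultimately show ?thesis using sets_restrict_PiM_coordinate[OF assms, of "PiE S (\<lambda>_. C)" S] by simp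
qed

context weighted_walk
begin

text \<open>Each added site multiplies the probability by a transition fixed by the pattern, so the
  total factor \<open>h\<close> is the same for every \<open>A\<close>. Disjointness of
  \<open>A\<close> from the region \<open>C\<close> ensures that a site new to \<open>W\<close> is
  also new to \<open>A \<union> W\<close>.\<close>

lemma prob_cylinder_factor:
  assumes "tree_ext G {u} W" "W \<subseteq> insert u C"
  shows "\<exists>h. \<forall>A t. subtree_top r A t \<and> u \<in> A \<and> A \<inter> C = {} \<longrightarrow>
    (\<exists>s. subtree_top r (A \<union> W) s) \<and> walk.prob (cylinder \<Omega> (A \<union> W) \<psi>) = walk.prob (cylinder \<Omega> A \<psi>) * h"
  using assms
proof (induction rule: tree_ext.induct)
  case base
  have "A \<union> {u} = A" if "u \<in> A" for A using that by blast
  then show ?case by (intro exI[of _ 1]) auto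
next
  case (step W x y)
  have "W \<subseteq> insert u C" using step.prems by blast
  from step.IH[OF this] obtain h where h: "\<And>A t. subtree_top r A t \<Longrightarrow> u \<in> A \<Longrightarrow> A \<inter> C = {} \<Longrightarrow>
    (\<exists>s. subtree_top r (A \<union> W) s) \<and> walk.prob (cylinder \<Omega> (A \<union> W) \<psi>) = walk.prob (cylinder \<Omega> A \<psi>) * h"
    by blast
  have "u \<in> W" using tree_ext_mono[OF step.hyps(1)] by simp
  then have y: "y \<in> C" using step.prems step.hyps(3) by auto
  show ?case
  proof (intro exI[of _ "h * trans_prob (\<psi> x) (\<psi> y)"] allI impI)
    fix A t assume A: "subtree_top r A t \<and> u \<in> A \<and> A \<inter> C = {}"
    then obtain s where s: "subtree_top r (A \<union> W) s" using h by blast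
    have xy: "x \<in> A \<union> W" "y \<notin> A \<union> W" using A y step.hyps by auto
    have eq: "A \<union> insert y W = insert y (A \<union> W)" by simp
    have "\<exists>s. subtree_top r (insert y (A \<union> W)) s"
      using subtree_top_insert_cases[OF s xy step.hyps(4)] by metis
    then show "(\<exists>s. subtree_top r (A \<union> insert y W) s) \<and>
        walk.prob (cylinder \<Omega> (A \<union> insert y W) \<psi>) =
        walk.prob (cylinder \<Omega> A \<psi>) * (h * trans_prob (\<psi> x) (\<psi> y))"
      unfolding eq using prob_cylinder_insert[OF s xy step.hyps(4), of \<psi>] h[of A t] A by simp
  qed
qed

lemma prob_cylinder_branches:
  assumes u: "u \<in> V" and F: "finite F" "\<And>v. v \<in> F \<Longrightarrow> G u v"
    and pos: "walk.prob (cylinder \<Omega> {u} \<psi>) \<noteq> 0"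
  shows "walk.prob (cylinder \<Omega> ({u} \<union> (\<Union>v\<in>F. comp_ball r u v (n v))) \<psi>) =
    walk.prob (cylinder \<Omega> {u} \<psi>) *
    (\<Prod>v\<in>F. walk.prob (cylinder \<Omega> ({u} \<union> comp_ball r u v (n v)) \<psi>) / walk.prob (cylinder \<Omega> {u} \<psi>))"
    (is "?P F = _ * (\<Prod>v\<in>F. ?h v)")
proof -
  have top: "subtree_top r {u} u" using u by (simp add: subtree_top_def)
  have sub: "comp_ball r u v k \<subseteq> {x. x \<noteq> u \<and> first_step u x = v}" if "G u v" for v k
    using Union_comp_ball[of r u v] comp_of_first_step[OF _ that] comp_of_site[OF _ that] by blast
  have "(\<exists>s. subtree_top r ({u} \<union> (\<Union>v\<in>F. comp_ball r u v (n v))) s) \<and> ?P F =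
      walk.prob (cylinder \<Omega> {u} \<psi>) * (\<Prod>v\<in>F. ?h v)"
    using F
  proof (induction F)
    case empty
    then show ?case using top by auto
  next
    case (insert v F)
    define A where "A = {u} \<union> (\<Union>v\<in>F. comp_ball r u v (n v))"
    define C where "C = {x. x \<noteq> u \<and> first_step u x = v}"
    define W where "W = {u} \<union> comp_ball r u v (n v)"
    have "tree_ext G {u} W" "W \<subseteq> insert u C"
      using tree_ext_comp_ball[of r u v] insert.prems sub[of v] unfolding W_def C_def by auto
    then obtain h where h: "\<And>A t. subtree_top r A t \<Longrightarrow> u \<in> A \<Longrightarrow> A \<inter> C = {} \<Longrightarrow>
      (\<exists>s. subtree_top r (A \<union> W) s) \<and> walk.prob (cylinder \<Omega> (A \<union> W) \<psi>) = walk.prob (cylinder \<Omega> A \<psi>) * h"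
      using prob_cylinder_factor[of u W C \<psi>] by blast
    \<comment> \<open>The choice \<open>A = {u}\<close> identifies \<open>h\<close> as the
      conditional probability of the branch pattern given the spin at \<open>u\<close>.\<close>
    have "{u} \<inter> C = {}" unfolding C_def by blast
    then have "walk.prob (cylinder \<Omega> ({u} \<union> W) \<psi>) = walk.prob (cylinder \<Omega> {u} \<psi>) * h"
      using h[OF top] by blast
    moreover have "{u} \<union> W = W" unfolding W_def by blast
    ultimately have hv: "h = ?h v" using pos unfolding W_def by (simp add: field_simps)
    have "comp_ball r u x (n x) \<inter> C = {}" if "x \<in> F" for x
      using sub[of x "n x"] insert.prems[of x] that insert.hyps(2) unfolding C_def by blast
    then have AC: "A \<inter> C = {}" unfolding A_def using \<open>{u} \<inter> C = {}\<close> by blast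
    have IH: "\<exists>s. subtree_top r A s" "?P F = walk.prob (cylinder \<Omega> {u} \<psi>) * (\<Prod>v\<in>F. ?h v)"
      using insert unfolding A_def by auto
    have eq: "{u} \<union> (\<Union>v\<in>insert v F. comp_ball r u v (n v)) = A \<union> W" unfolding A_def W_def by blast
    obtain s where s: "subtree_top r A s" using IH(1) by blast
    have "u \<in> A" unfolding A_def by simp
    from h[OF s this AC] show ?case
      unfolding eq using IH(2) hv insert.hyps unfolding A_def by simp
  qed
  then show ?thesis by blast
qed

text \<open>Independence is tested on generating pi-systems, the cylinders over balls in each
  component. There it is the factorisation over branches, divided by the probability of the spin at
  \<open>u\<close>.\<close>

lemma walk_indep_branches:
  assumes u: "u \<in> V" and nz: "emeasure walk_measure {\<phi> \<in> space walk_measure. \<phi> u = i} \<noteq> 0"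
  shows "prob_space.indep_vars (uniform_measure walk_measure {\<phi> \<in> space walk_measure. \<phi> u = i})
    (\<lambda>v. PiM (comp_of G u v) (\<lambda>_. count_space {1..q})) (\<lambda>v \<phi>. restrict \<phi> (comp_of G u v)) {v \<in> V. G u v}"
proof -
  define A where "A = {\<phi> \<in> space walk_measure. \<phi> u = i}"
  define N where "N = {v \<in> V. G u v}"
  define X where "X = (\<lambda>v (\<phi> :: nat list \<Rightarrow> nat). restrict \<phi> (comp_of G u v))"
  define S where "S = (\<lambda>v. PiE (comp_of G u v) (\<lambda>_. {1..q}))"
  define U where "U = uniform_measure walk_measure A"
  have A_cyl: "A = cylinder \<Omega> {u} \<psi>" if "\<psi> u = i" for \<psi>
    using that unfolding A_def by (auto simp: cylinder_def)
  have nzA: "walk.prob A \<noteq> 0" using nz unfolding A_def by (simp add: walk.emeasure_eq_measure)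
  interpret U: prob_space U
    unfolding U_def by (rule prob_space_uniform_measure) (use nz in \<open>simp_all add: A_def\<close>)
  have spU: "space U = \<Omega>" by (simp add: U_def)
  have NG: "G u v" if "v \<in> N" for v using that by (simp add: N_def)
  have comp_V: "comp_of G u v \<subseteq> V" if "v \<in> N" for v using comp_of_site[OF _ NG[OF that]] by blast
  have XS: "X v \<phi> \<in> S v" if "v \<in> N" "\<phi> \<in> \<Omega>" for v \<phi>
    using comp_V[OF that(1)] homs_range[OF that(2)] unfolding X_def S_def by (auto simp: PiE_iff)
  have sets_M: "sets (PiM (comp_of G u v) (\<lambda>_. count_space {1..q})) =
      sigma_sets (S v) (exhaustion_cylinders (S v) (comp_ball r u v))" if "v \<in> N" for v
    unfolding S_def
    by (subst sets_PiM_coordinate, simp, rule sigma_sets_exhaustion_cylinders[symmetric, where C = "{1..q}"])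
      (use tree_ext_comp_ball[OF NG[OF that]] Union_comp_ball in auto)
  have finN: "finite N" unfolding N_def by (rule finite_subset[OF _ finite_neighbours[of r u]]) auto
  have neN: "N \<noteq> {}"
  proof (cases "u = []")
    case True
    have "[0] \<in> V" by (simp add: tree_sites_def)
    then have "[0] \<in> N" unfolding N_def using tree_adj_butlast[of "[0]" r] True by simp
    then show ?thesis by blast
  next
    case False
    then have "butlast u \<in> N" unfolding N_def
      using u butlast_site tree_adj_sym[OF tree_adj_butlast[OF u False]] by simp
    then show ?thesis by blast
  qed
  have "U.indep_vars (\<lambda>v. PiM (comp_of G u v) (\<lambda>_. count_space {1..q})) X N"
  proof (subst U.indep_vars_finite[where E = "\<lambda>v. exhaustion_cylinders (S v) (comp_ball r u v)"])
    show "N \<noteq> {}" "finite N" by (fact neN finN)+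
    fix v assume v: "v \<in> N"
    show "sets (PiM (comp_of G u v) (\<lambda>_. count_space {1..q})) =
        sigma_sets (space (PiM (comp_of G u v) (\<lambda>_. count_space {1..q}))) (exhaustion_cylinders (S v) (comp_ball r u v))"
      using sets_M[OF v] by (simp add: space_PiM S_def)
    show "Int_stable (exhaustion_cylinders (S v) (comp_ball r u v))"
      by (rule Int_stable_exhaustion_cylinders[OF incseq_comp_ball])
    show "space (PiM (comp_of G u v) (\<lambda>_. count_space {1..q})) \<in> exhaustion_cylinders (S v) (comp_ball r u v)"
      unfolding exhaustion_cylinders_def S_def
      by (intro insertI2 CollectI exI[of _ 0]) (simp add: space_PiM)
    show "exhaustion_cylinders (S v) (comp_ball r u v) \<subseteq> Pow (space (PiM (comp_of G u v) (\<lambda>_. count_space {1..q})))"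
      using exhaustion_cylinders_subset[of "S v"] by (simp add: space_PiM S_def)
    show "X v \<in> measurable U (PiM (comp_of G u v) (\<lambda>_. count_space {1..q}))"
    proof (rule measurable_sigma_sets)
      show "sets (PiM (comp_of G u v) (\<lambda>_. count_space {1..q})) = sigma_sets (S v) (coordinate_events (S v) (comp_of G u v))"
        unfolding S_def by (rule sets_PiM_coordinate) simp
      show "coordinate_events (S v) (comp_of G u v) \<subseteq> Pow (S v)" by (rule coordinate_events_subset)
      show "X v \<in> space U \<rightarrow> S v" using XS[OF v] by (simp add: spU)
      fix B assume "B \<in> coordinate_events (S v) (comp_of G u v)"
      then obtain x j where B: "B = {\<phi> \<in> S v. \<phi> x = j}" "x \<in> comp_of G u v" by (auto simp: coordinate_events_def)
      have "X v -` B \<inter> space U = cylinder \<Omega> {x} (\<lambda>_. j)"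
        using XS[OF v] B by (auto simp: cylinder_def spU) (auto simp: X_def)
      then show "X v -` B \<inter> space U \<in> sets U"
        using cylinder_measurable[of "{x}"] comp_V[OF v] B(2) by (auto simp: U_def)
    qed
  next
    show "\<forall>B\<in>(\<Pi> v\<in>N. exhaustion_cylinders (S v) (comp_ball r u v)).
        U.prob (\<Inter>v\<in>N. X v -` B v \<inter> space U) = (\<Prod>v\<in>N. U.prob (X v -` B v \<inter> space U))"
    proof
      fix B assume B: "B \<in> (\<Pi> v\<in>N. exhaustion_cylinders (S v) (comp_ball r u v))"
      show "U.prob (\<Inter>v\<in>N. X v -` B v \<inter> space U) = (\<Prod>v\<in>N. U.prob (X v -` B v \<inter> space U))"
      proof (cases "\<exists>v\<in>N. B v = {}")
        case True
        then obtain v where v: "v \<in> N" "B v = {}" by blast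
        then have "(\<Inter>v\<in>N. X v -` B v \<inter> space U) = {}" by blast
        moreover have "(\<Prod>v\<in>N. U.prob (X v -` B v \<inter> space U)) = 0"
          using finN v by (intro prod_zero bexI[of _ v]) simp_all
        ultimately show ?thesis by simp
      next
        case False
        have "\<forall>v\<in>N. \<exists>n. \<exists>\<psi>. B v = cylinder (S v) (comp_ball r u v n) \<psi>"
        proof
          fix v assume v: "v \<in> N"
          then have "B v \<in> exhaustion_cylinders (S v) (comp_ball r u v)" using B by (rule Pi_mem[rotated])
          moreover have "B v \<noteq> {}" using False v by blast
          ultimately show "\<exists>n. \<exists>\<psi>. B v = cylinder (S v) (comp_ball r u v n) \<psi>"
            unfolding exhaustion_cylinders_def by blast
        qed
        from bchoice[OF this] obtain n where "\<forall>v\<in>N. \<exists>\<psi>. B v = cylinder (S v) (comp_ball r u v (n v)) \<psi>" ..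
        from bchoice[OF this] obtain \<psi> where
          n: "\<And>v. v \<in> N \<Longrightarrow> B v = cylinder (S v) (comp_ball r u v (n v)) (\<psi> v)" by blast
        \<comment> \<open>The patterns on the single branches are glued to one configuration;
          \<open>first_step\<close> selects the branch to which a site belongs.\<close>
        define \<Psi> where "\<Psi> = (\<lambda>x. if x = u then i else \<psi> (first_step u x) x)"
        let ?D = "\<lambda>v. comp_ball r u v (n v)"
        have Dsub: "?D v \<subseteq> comp_of G u v" for v using Union_comp_ball[of r u v] by blast
        have pre: "X v -` B v \<inter> space U = cylinder \<Omega> (?D v) \<Psi>" if v: "v \<in> N" for v
        proof -
          have \<Psi>: "\<Psi> x = \<psi> v x" if "x \<in> ?D v" for x
            using comp_of_first_step[OF _ NG[OF v], of x] comp_of_site[OF _ NG[OF v], of x] Dsub[of v] that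
            unfolding \<Psi>_def by auto
          have "X v \<phi> \<in> B v \<longleftrightarrow> (\<forall>x\<in>?D v. \<phi> x = \<Psi> x)" if "\<phi> \<in> \<Omega>" for \<phi>
            using XS[OF v that] Dsub[of v] \<Psi> unfolding n[OF v] cylinder_def X_def by (auto simp: subset_iff)
          then show ?thesis by (auto simp: cylinder_def spU)
        qed
        have \<Psi>u: "\<Psi> u = i" by (simp add: \<Psi>_def)
        note Ac = A_cyl[of \<Psi>, OF \<Psi>u]
        have D: "finite (?D v)" "?D v \<subseteq> V" if "v \<in> N" for v
          using tree_ext_comp_ball[OF NG[OF that]] Dsub[of v] comp_V[OF that] by auto
        have U_prob: "U.prob (cylinder \<Omega> W \<Psi>) = walk.prob (cylinder \<Omega> ({u} \<union> W) \<Psi>) / walk.prob (cylinder \<Omega> {u} \<Psi>)"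
          if "finite W" "W \<subseteq> V" for W
        proof -
          have "A \<inter> cylinder \<Omega> W \<Psi> = cylinder \<Omega> ({u} \<union> W) \<Psi>" unfolding Ac by (auto simp: cylinder_def)
          then show ?thesis
            using measure_uniform_measure[of walk_measure A "cylinder \<Omega> W \<Psi>"] cylinder_measurable[OF that] nz
            unfolding U_def Ac[symmetric] by (simp add: A_def walk.emeasure_eq_measure)
        qed
        have "(\<Inter>v\<in>N. X v -` B v \<inter> space U) = cylinder \<Omega> (\<Union>v\<in>N. ?D v) \<Psi>"
          using pre neN by (auto simp: cylinder_def)
        then have "U.prob (\<Inter>v\<in>N. X v -` B v \<inter> space U) =
            walk.prob (cylinder \<Omega> ({u} \<union> (\<Union>v\<in>N. ?D v)) \<Psi>) / walk.prob (cylinder \<Omega> {u} \<Psi>)"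
          using U_prob[of "\<Union>v\<in>N. ?D v"] D finN by auto
        also have "\<dots> = (\<Prod>v\<in>N. walk.prob (cylinder \<Omega> ({u} \<union> ?D v) \<Psi>) / walk.prob (cylinder \<Omega> {u} \<Psi>))"
          using prob_cylinder_branches[OF u finN NG, of \<Psi> n] nzA unfolding Ac by simp
        also have "\<dots> = (\<Prod>v\<in>N. U.prob (X v -` B v \<inter> space U))"
          using pre U_prob D by (intro prod.cong) auto
        finally show ?thesis .
      qed
    qed
  qed
  then show ?thesis unfolding U_def A_def X_def N_def .
qed

end

section \<open>The Gibbs property\<close>

text \<open>On the configurations that agree with \<open>\<psi>\<close> off \<open>U\<close> the finite-volume measure is proportional
  to this weight of the restriction \<open>\<sigma>\<close> to \<open>U\<close>.\<close>

definition patch_weight :: "'v set \<Rightarrow> ('v \<Rightarrow> 'v \<Rightarrow> bool) \<Rightarrow> nat \<Rightarrow> (nat \<Rightarrow> nat \<Rightarrow> bool)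
     \<Rightarrow> (nat \<Rightarrow> real) \<Rightarrow> 'v set \<Rightarrow> ('v \<Rightarrow> nat) \<Rightarrow> ('v \<Rightarrow> nat) \<Rightarrow> real" where
  "patch_weight V G q E lam U \<sigma> \<psi> =
    (if (\<forall>u\<in>U. \<sigma> u \<in> {1..q}) \<and>
        (\<forall>u\<in>U \<union> bdry V G U. \<forall>v\<in>U \<union> bdry V G U. G u v \<longrightarrow> E (override_on \<psi> \<sigma> U u) (override_on \<psi> \<sigma> U v))
     then \<Prod>u\<in>U. lam (\<sigma> u) else 0)"

lemma patch_weight_nonneg:
  assumes "\<forall>i\<in>{1..q}. lam i > 0"
  shows "patch_weight V G q E lam U \<sigma> \<psi> \<ge> 0"
  unfolding patch_weight_def using assms by (auto intro!: prod_nonneg simp: less_imp_le)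

text \<open>Bounds finite-volume probabilities by 1 and shows that a vanishing denominator forces a
  vanishing numerator. As \<open>\<sigma>\<close> is an arbitrary function, it is cut down to
  \<open>U\<close> before it appears among the summands.\<close>

lemma patch_weight_le_sum:
  assumes lam: "\<forall>i\<in>{1..q}. lam i > 0" and U: "finite U"
  shows "patch_weight V G q E lam U \<sigma> \<psi> \<le> (\<Sum>\<tau>\<in>PiE U (\<lambda>_. {1..q}). patch_weight V G q E lam U \<tau> \<psi>)"
proof (cases "\<forall>u\<in>U. \<sigma> u \<in> {1..q}")
  case True
  have "override_on \<psi> (restrict \<sigma> U) U = override_on \<psi> \<sigma> U" by (auto simp: override_on_def)
  then have "patch_weight V G q E lam U \<sigma> \<psi> = patch_weight V G q E lam U (restrict \<sigma> U) \<psi>"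
    by (auto simp: patch_weight_def)
  also have "\<dots> \<le> (\<Sum>\<tau>\<in>PiE U (\<lambda>_. {1..q}). patch_weight V G q E lam U \<tau> \<psi>)"
    using True U patch_weight_nonneg[OF lam]
    by (intro member_le_sum[where f = "\<lambda>\<tau>. patch_weight V G q E lam U \<tau> \<psi>"] finite_PiE) auto
  finally show ?thesis .
next
  case False
  then have "patch_weight V G q E lam U \<sigma> \<psi> = 0" by (auto simp: patch_weight_def)
  then show ?thesis by (simp only:) (intro sum_nonneg patch_weight_nonneg[OF lam])
qed

text \<open>With the boundary spins prescribed, a configuration on the enlarged patch is a choice of
  spins on \<open>U\<close>; the activities of the boundary sites form a common factor
  \<open>L > 0\<close> that cancels.\<close>

lemma spec_cond_eq_patch_weight:
  assumes lam: "\<forall>i\<in>{1..q}. lam i > 0" and U: "finite U" "finite (bdry V G U)"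
    and \<psi>: "\<forall>v\<in>bdry V G U. \<psi> v \<in> {1..q}"
  shows "spec_cond V G q E lam U \<sigma> \<psi> =
    patch_weight V G q E lam U \<sigma> \<psi> / (\<Sum>\<tau>\<in>PiE U (\<lambda>_. {1..q}). patch_weight V G q E lam U \<tau> \<psi>)"
proof -
  define B where "B = bdry V G U"
  define L where "L = (\<Prod>v\<in>B. lam (\<psi> v))"
  define H where "H = (\<lambda>\<tau>. \<forall>u\<in>U \<union> B. \<forall>v\<in>U \<union> B. G u v \<longrightarrow> E (override_on \<psi> \<tau> U u) (override_on \<psi> \<tau> U v))"
  define ext where "ext = (\<lambda>\<tau>. restrict (override_on \<psi> \<tau> U) (U \<union> B))"
  have disj: "U \<inter> B = {}" by (auto simp: B_def bdry_def)
  have L: "L > 0" unfolding L_def using \<psi> lam by (intro prod_pos) (auto simp: B_def)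
  have weight: "lam_weight lam (U \<union> B) (ext \<tau>) = L * (\<Prod>u\<in>U. lam (\<tau> u))" for \<tau>
  proof -
    have "lam_weight lam (U \<union> B) (ext \<tau>) = (\<Prod>u\<in>U. lam (ext \<tau> u)) * (\<Prod>u\<in>B. lam (ext \<tau> u))"
      unfolding lam_weight_def using U disj by (intro prod.union_disjoint) (auto simp: B_def)
    also have "(\<Prod>u\<in>U. lam (ext \<tau> u)) = (\<Prod>u\<in>U. lam (\<tau> u))"
      by (intro prod.cong) (auto simp: ext_def)
    also have "(\<Prod>u\<in>B. lam (ext \<tau> u)) = L"
      unfolding L_def using disj by (intro prod.cong) (auto simp: ext_def override_on_def)
    finally show ?thesis by simp
  qed
  have ext_hom: "ext \<tau> \<in> homs (U \<union> B) G q E \<longleftrightarrow> (\<forall>u\<in>U. \<tau> u \<in> {1..q}) \<and> H \<tau>" for \<tau>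
    using \<psi> disj unfolding homs_def H_def ext_def B_def[symmetric]
    by (auto simp: PiE_iff override_on_def)
  have ext_eq: "chi = ext \<tau>"
    if "chi \<in> homs (U \<union> B) G q E" "\<forall>v\<in>B. chi v = \<psi> v" "\<forall>u\<in>U. chi u = \<tau> u" for chi \<tau>
  proof
    fix x show "chi x = ext \<tau> x"
      using that disj by (cases "x \<in> U \<union> B") (auto simp: homs_def PiE_iff extensional_def ext_def override_on_def)
  qed
  have ext_app: "ext \<tau> v = \<psi> v" if "v \<in> B" for \<tau> v using that disj by (auto simp: ext_def override_on_def)
  have ext_U: "ext \<tau> u = \<tau> u" if "u \<in> U" for \<tau> u using that by (auto simp: ext_def)
  let ?Den = "{chi \<in> homs (U \<union> B) G q E. \<forall>v\<in>B. chi v = \<psi> v}"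
  let ?Num = "{chi \<in> homs (U \<union> B) G q E. (\<forall>u\<in>U. chi u = \<sigma> u) \<and> (\<forall>v\<in>B. chi v = \<psi> v)}"
  have pw: "patch_weight V G q E lam U \<tau> \<psi> = (if (\<forall>u\<in>U. \<tau> u \<in> {1..q}) \<and> H \<tau> then \<Prod>u\<in>U. lam (\<tau> u) else 0)" for \<tau>
    by (simp add: patch_weight_def H_def B_def)
  have "(\<Sum>chi\<in>?Den. lam_weight lam (U \<union> B) chi) =
      (\<Sum>\<tau>\<in>{\<tau> \<in> PiE U (\<lambda>_. {1..q}). H \<tau>}. L * (\<Prod>u\<in>U. lam (\<tau> u)))"
  proof (rule sum.reindex_bij_witness[where i = ext and j = "\<lambda>chi. restrict chi U"])
    fix chi assume chi: "chi \<in> ?Den"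
    then show eq: "ext (restrict chi U) = chi" by (intro ext_eq[symmetric]) auto
    then have "ext (restrict chi U) \<in> homs (U \<union> B) G q E" using chi by simp
    then show "restrict chi U \<in> {\<tau> \<in> PiE U (\<lambda>_. {1..q}). H \<tau>}" unfolding ext_hom by auto
    show "L * (\<Prod>u\<in>U. lam (restrict chi U u)) = lam_weight lam (U \<union> B) chi"
      using weight[of "restrict chi U"] unfolding eq by simp
  next
    fix \<tau> assume \<tau>: "\<tau> \<in> {\<tau> \<in> PiE U (\<lambda>_. {1..q}). H \<tau>}"
    then show "restrict (ext \<tau>) U = \<tau>"
      by (auto simp: fun_eq_iff restrict_def ext_U PiE_iff extensional_def)
    show "ext \<tau> \<in> ?Den" using \<tau> ext_hom ext_app by (auto simp: PiE_iff)
  qed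
  also have "\<dots> = L * (\<Sum>\<tau>\<in>PiE U (\<lambda>_. {1..q}). patch_weight V G q E lam U \<tau> \<psi>)"
    unfolding sum_distrib_left
  proof (rule sum.mono_neutral_cong_left)
    show "finite (PiE U (\<lambda>_. {1..q}))" using U by (intro finite_PiE) auto
  qed (auto simp: pw)
  finally have den: "(\<Sum>chi\<in>?Den. lam_weight lam (U \<union> B) chi) =
    L * (\<Sum>\<tau>\<in>PiE U (\<lambda>_. {1..q}). patch_weight V G q E lam U \<tau> \<psi>)" .
  have num: "(\<Sum>chi\<in>?Num. lam_weight lam (U \<union> B) chi) = L * patch_weight V G q E lam U \<sigma> \<psi>"
  proof (cases "(\<forall>u\<in>U. \<sigma> u \<in> {1..q}) \<and> H \<sigma>")
    case True
    then have "?Num = {ext \<sigma>}" using ext_eq ext_hom ext_app ext_U by auto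
    then show ?thesis using weight[of \<sigma>] True by (simp add: pw)
  next
    case False
    then have "?Num = {}" using ext_eq ext_hom by blast
    then have "(\<Sum>chi\<in>?Num. lam_weight lam (U \<union> B) chi) = 0" by (simp only: sum.empty)
    then show ?thesis by (simp only: pw False if_False mult_zero_right)
  qed
  show ?thesis
    unfolding spec_cond_def Let_def B_def[symmetric] num den using L by simp
qed

lemma spec_cond_cong:
  "(\<And>v. v \<in> bdry V G U \<Longrightarrow> \<psi> v = \<psi>' v) \<Longrightarrow> spec_cond V G q E lam U \<sigma> \<psi> = spec_cond V G q E lam U \<sigma> \<psi>'"
  by (simp add: spec_cond_def cong: conj_cong)

section \<open>Weights of balls and the conditional expectation given the outside\<close>

context weighted_walk
begin

text \<open>Every site within distance \<open>n\<close> of the root contributes \<open>z\<close> to the power \<open>- r\<close>: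
  the root has \<open>r + 1\<close> children, but its law carries an extra factor \<open>z\<close>.\<close>

lemma prob_cylinder_ball:
  assumes kap: "\<forall>i\<in>{1..q}. w i = \<kappa> * lam i * z i ^ r"
  shows "walk.prob (cylinder \<Omega> {v \<in> V. length v \<le> Suc n} \<phi>) =
    (if \<forall>u\<in>{v \<in> V. length v \<le> Suc n}. \<forall>v\<in>{v \<in> V. length v \<le> Suc n}. G u v \<longrightarrow> E (\<phi> u) (\<phi> v)
     then (\<Prod>v\<in>{v \<in> V. length v \<le> n}. \<kappa> * lam (\<phi> v)) * (\<Prod>v\<in>{v \<in> V. length v = Suc n}. w (\<phi> v)) / total
     else 0)"
proof -
  define B where "B = {v \<in> V. length v \<le> Suc n}"
  define B' where "B' = {v \<in> V. length v \<le> n}"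
  define S where "S = {v \<in> V. length v = Suc n}"
  have BS: "B = B' \<union> S" "B' \<inter> S = {}" by (auto simp: B_def B'_def S_def)
  have "finite B" unfolding B_def by (rule finite_ball)
  then have fin: "finite B" "finite B'" "finite S" unfolding BS by auto
  have root: "[] \<in> B'" "[] \<in> B" by (auto simp: B_def B'_def)
  have prob: "walk.prob (cylinder \<Omega> B \<phi>) = root_prob (\<phi> []) * (\<Prod>v\<in>B - {[]}. trans_prob (\<phi> (butlast v)) (\<phi> v))"
    unfolding B_def by (rule prob_cylinder_top[OF subtree_top_ball])
  have edges: "(\<forall>u\<in>B. \<forall>v\<in>B. G u v \<longrightarrow> E (\<phi> u) (\<phi> v)) \<longleftrightarrow> (\<forall>v\<in>B - {[]}. E (\<phi> (butlast v)) (\<phi> v))"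
  proof
    assume *: "\<forall>u\<in>B. \<forall>v\<in>B. G u v \<longrightarrow> E (\<phi> u) (\<phi> v)"
    show "\<forall>v\<in>B - {[]}. E (\<phi> (butlast v)) (\<phi> v)"
    proof
      fix v assume v: "v \<in> B - {[]}"
      then have "butlast v \<in> B" "G (butlast v) v"
        using butlast_site tree_adj_butlast unfolding B_def by auto
      then show "E (\<phi> (butlast v)) (\<phi> v)" using * v by blast
    qed
  next
    assume "\<forall>v\<in>B - {[]}. E (\<phi> (butlast v)) (\<phi> v)"
    then show "\<forall>u\<in>B. \<forall>v\<in>B. G u v \<longrightarrow> E (\<phi> u) (\<phi> v)"
      using edge_sym by (auto simp: tree_adj_def)
  qed
  show ?thesis
  proof (cases "\<forall>v\<in>B - {[]}. E (\<phi> (butlast v)) (\<phi> v)")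
    case False
    then have "\<exists>v\<in>B - {[]}. trans_prob (\<phi> (butlast v)) (\<phi> v) = 0" by (auto simp: trans_prob_def)
    then have "(\<Prod>v\<in>B - {[]}. trans_prob (\<phi> (butlast v)) (\<phi> v)) = 0" using fin by (intro prod_zero) auto
    then have "walk.prob (cylinder \<Omega> B \<phi>) = 0" using prob by simp
    moreover have "\<not> (\<forall>u\<in>B. \<forall>v\<in>B. G u v \<longrightarrow> E (\<phi> u) (\<phi> v))" using False edges by blast
    ultimately show ?thesis unfolding B_def by (simp only: if_False)
  next
    case True
    \<comment> \<open>The radius is at least 1, so every site of the ball, the root included, lies
      on an edge inside it, and the ends of edges carry valid spins.\<close>
    have "[0] \<in> B - {[]}" by (simp add: B_def tree_sites_def)
    then have "E (\<phi> []) (\<phi> [0])" using True by force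
    then have valid: "\<phi> v \<in> {1..q}" if "v \<in> B" for v
      using True edge_range that by (cases "v = []") auto
    \<comment> \<open>The denominators are grouped by parent. A site of \<open>B'\<close> has all
      its children in \<open>B\<close>.\<close>
    have "(\<Prod>v\<in>B - {[]}. z (\<phi> (butlast v))) = (\<Prod>u\<in>B'. \<Prod>v\<in>{v \<in> B - {[]}. butlast v = u}. z (\<phi> (butlast v)))"
    proof (rule prod.group[symmetric])
      show "butlast ` (B - {[]}) \<subseteq> B'" using butlast_site by (auto simp: B_def B'_def)
    qed (use fin in auto)
    also have "\<dots> = (\<Prod>u\<in>B'. z (\<phi> u) ^ (if u = [] then Suc r else r))"
    proof (rule prod.cong[OF refl])
      fix u assume u: "u \<in> B'"
      have "{v \<in> B - {[]}. butlast v = u} = {v \<in> V. v \<noteq> [] \<and> butlast v = u}"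
        using u by (auto simp: B_def B'_def)
      then show "(\<Prod>v\<in>{v \<in> B - {[]}. butlast v = u}. z (\<phi> (butlast v))) = z (\<phi> u) ^ (if u = [] then Suc r else r)"
        using card_children[of u r] u by (simp add: B'_def)
    qed
    also have "\<dots> = z (\<phi> []) * (\<Prod>u\<in>B'. z (\<phi> u) ^ r)"
      using fin root by (simp add: prod.remove[of B' "[]"])
    finally have pz: "(\<Prod>v\<in>B - {[]}. z (\<phi> (butlast v))) = z (\<phi> []) * (\<Prod>u\<in>B'. z (\<phi> u) ^ r)" .
    have zpos: "(\<Prod>u\<in>B'. z (\<phi> u) ^ r) > 0" "z (\<phi> []) > 0"
      using valid z_pos BS root by (auto intro!: prod_pos)
    have "(\<Prod>v\<in>B - {[]}. trans_prob (\<phi> (butlast v)) (\<phi> v)) = (\<Prod>v\<in>B - {[]}. w (\<phi> v) / z (\<phi> (butlast v)))"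
      using True by (intro prod.cong) (auto simp: trans_prob_def)
    also have "\<dots> = (\<Prod>v\<in>B - {[]}. w (\<phi> v)) / (z (\<phi> []) * (\<Prod>u\<in>B'. z (\<phi> u) ^ r))"
      by (simp only: prod_dividef pz)
    finally have "walk.prob (cylinder \<Omega> B \<phi>) =
        (w (\<phi> []) * (\<Prod>v\<in>B - {[]}. w (\<phi> v))) / (\<Prod>u\<in>B'. z (\<phi> u) ^ r) / total"
      using prob valid[OF root(2)] zpos by (simp add: root_prob_def)
    also have "w (\<phi> []) * (\<Prod>v\<in>B - {[]}. w (\<phi> v)) = (\<Prod>v\<in>B. w (\<phi> v))"
      using fin root by (simp add: prod.remove[of B "[]"])
    also have "\<dots> = (\<Prod>v\<in>B'. w (\<phi> v)) * (\<Prod>v\<in>S. w (\<phi> v))"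
      using BS fin by (simp add: prod.union_disjoint)
    also have "(\<Prod>v\<in>B'. w (\<phi> v)) = (\<Prod>v\<in>B'. \<kappa> * lam (\<phi> v) * z (\<phi> v) ^ r)"
      by (intro prod.cong refl) (use kap valid BS in blast)
    also have "\<dots> = (\<Prod>v\<in>B'. \<kappa> * lam (\<phi> v)) * (\<Prod>u\<in>B'. z (\<phi> u) ^ r)"
      by (rule prod.distrib)
    finally have "walk.prob (cylinder \<Omega> B \<phi>) = (\<Prod>v\<in>B'. \<kappa> * lam (\<phi> v)) * (\<Prod>v\<in>S. w (\<phi> v)) / total"
      using zpos by simp
    then show ?thesis using True edges unfolding B_def B'_def S_def by simp
  qed
qed

lemma bdry_subset_ball:
  assumes "U \<subseteq> {v \<in> V. length v \<le> n}"
  shows "bdry V G U \<subseteq> {v \<in> V. length v \<le> Suc n}"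
proof
  fix v assume "v \<in> bdry V G U"
  then obtain u where "u \<in> U" "G u v" "v \<in> V" by (auto simp: bdry_def)
  then show "v \<in> {v \<in> V. length v \<le> Suc n}" using tree_adj_length[of r u v] assms by auto
qed

text \<open>The ball has one layer more than the one containing \<open>U\<close>: the outer layer
  carries \<open>w\<close> instead of \<open>lam\<close> and must avoid \<open>U\<close>, and the
  larger ball contains the boundary of \<open>U\<close>. The witness for \<open>c\<close> involves
  \<open>\<psi>\<close> only off \<open>U\<close>.\<close>

lemma prob_cylinder_patch:
  assumes kap: "\<forall>i\<in>{1..q}. w i = \<kappa> * lam i * z i ^ r"
    and U: "U \<subseteq> {v \<in> V. length v \<le> n}"
  shows "\<exists>c. \<forall>\<sigma>. walk.prob (cylinder \<Omega> {v \<in> V. length v \<le> Suc n} (override_on \<psi> \<sigma> U)) =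
    c * patch_weight V G q E lam U \<sigma> \<psi>"
proof -
  define B where "B = {v \<in> V. length v \<le> Suc n}"
  define B' where "B' = {v \<in> V. length v \<le> n}"
  define S where "S = {v \<in> V. length v = Suc n}"
  define Up where "Up = U \<union> bdry V G U"
  define hom where "hom = (\<lambda>X \<phi>. \<forall>u\<in>X. \<forall>v\<in>X. G u v \<longrightarrow> E (\<phi> u) (\<phi> v))"
  define c where "c = (if hom (B - U) \<psi> then
    \<kappa> ^ card U * (\<Prod>v\<in>B' - U. \<kappa> * lam (\<psi> v)) * (\<Prod>v\<in>S. w (\<psi> v)) / total else 0)"
  have fin: "finite B'" unfolding B'_def by (rule finite_ball)
  have UB: "U \<subseteq> B'" "B' \<subseteq> B" "U \<inter> S = {}" using U by (auto simp: B_def B'_def S_def)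
  have Up: "Up \<subseteq> B" using bdry_subset_ball[OF U] UB unfolding Up_def B_def[symmetric] by blast
  have "walk.prob (cylinder \<Omega> B (override_on \<psi> \<sigma> U)) = c * patch_weight V G q E lam U \<sigma> \<psi>" for \<sigma>
  proof -
    define \<phi> where "\<phi> = override_on \<psi> \<sigma> U"
    have \<phi>U: "\<phi> v = \<sigma> v" if "v \<in> U" for v using that by (simp add: \<phi>_def)
    have \<phi>: "\<phi> v = \<psi> v" if "v \<notin> U" for v using that by (simp add: \<phi>_def)
    have prob: "walk.prob (cylinder \<Omega> B \<phi>) =
        (if hom B \<phi> then (\<Prod>v\<in>B'. \<kappa> * lam (\<phi> v)) * (\<Prod>v\<in>S. w (\<phi> v)) / total else 0)"
      unfolding B_def B'_def S_def hom_def by (rule prob_cylinder_ball[OF kap])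
    have "hom (B - U) \<phi> = hom (B - U) \<psi>" unfolding hom_def using \<phi> by simp
    \<comment> \<open>An edge with an end in \<open>U\<close> has both ends in \<open>Up\<close>;
      every other edge of the ball lies in \<open>B - U\<close>.\<close>
    moreover have "hom B \<phi> \<longleftrightarrow> hom Up \<phi> \<and> hom (B - U) \<phi>"
    proof
      assume "hom B \<phi>"
      then show "hom Up \<phi> \<and> hom (B - U) \<phi>" using Up unfolding hom_def by blast
    next
      assume *: "hom Up \<phi> \<and> hom (B - U) \<phi>"
      have "E (\<phi> u) (\<phi> v)" if uv: "u \<in> B" "v \<in> B" "G u v" for u v
      proof (cases "u \<in> U \<or> v \<in> U")
        case True
        then have "u \<in> Up \<and> v \<in> Up"
          using uv tree_adj_sym[OF uv(3)] tree_adj_sites[OF uv(3)] unfolding Up_def bdry_def by blast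
        then show ?thesis using * uv unfolding hom_def by blast
      next
        case False
        then show ?thesis using * uv unfolding hom_def by blast
      qed
      then show "hom B \<phi>" unfolding hom_def by blast
    qed
    ultimately have hom_iff: "hom B \<phi> \<longleftrightarrow> hom Up \<phi> \<and> hom (B - U) \<psi>" by simp
    have pw: "patch_weight V G q E lam U \<sigma> \<psi> =
        (if (\<forall>u\<in>U. \<sigma> u \<in> {1..q}) \<and> hom Up \<phi> then \<Prod>u\<in>U. lam (\<sigma> u) else 0)"
      unfolding patch_weight_def hom_def Up_def \<phi>_def ..
    have "(\<Prod>v\<in>B'. \<kappa> * lam (\<phi> v)) = (\<Prod>v\<in>U. \<kappa> * lam (\<phi> v)) * (\<Prod>v\<in>B' - U. \<kappa> * lam (\<phi> v))"
      using fin UB by (subst prod.subset_diff[of U B']) (auto simp: mult.commute)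
    also have "(\<Prod>v\<in>U. \<kappa> * lam (\<phi> v)) = \<kappa> ^ card U * (\<Prod>u\<in>U. lam (\<sigma> u))"
      by (simp add: prod.distrib \<phi>U)
    also have "(\<Prod>v\<in>B' - U. \<kappa> * lam (\<phi> v)) = (\<Prod>v\<in>B' - U. \<kappa> * lam (\<psi> v))"
      using \<phi> by (intro prod.cong) auto
    finally have 1: "(\<Prod>v\<in>B'. \<kappa> * lam (\<phi> v)) =
      \<kappa> ^ card U * (\<Prod>u\<in>U. lam (\<sigma> u)) * (\<Prod>v\<in>B' - U. \<kappa> * lam (\<psi> v))" .
    have "\<phi> v = \<psi> v" if "v \<in> S" for v using \<phi> UB(3) that by blast
    then have 2: "(\<Prod>v\<in>S. w (\<phi> v)) = (\<Prod>v\<in>S. w (\<psi> v))" by simp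
    show ?thesis
    proof (cases "\<forall>u\<in>U. \<sigma> u \<in> {1..q}")
      case True
      then show ?thesis
        unfolding \<phi>_def[symmetric] prob pw c_def 1 2 hom_iff by simp
    next
      case False
      then obtain u where u: "u \<in> U" "\<sigma> u \<notin> {1..q}" by blast
      then have "cylinder \<Omega> B \<phi> = {}"
        using UB homs_range[of _ u] \<phi>U[of u] unfolding cylinder_def B_def B'_def by fastforce
      then show ?thesis
        unfolding \<phi>_def[symmetric] pw by (simp only: False simp_thms if_False measure_empty mult_zero_right)
    qed
  qed
  then show ?thesis unfolding B_def by blast
qed

text \<open>The finite-volume probability is shown to be a version of the conditional expectation by
  comparing integrals over outside events. Reading these integrals as finite measures on the outside
  sigma-algebra reduces the comparison to cylinders over finite outside sets.\<close>

lemma gibbs_walk_measure: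
  assumes kap: "\<forall>i\<in>{1..q}. w i = \<kappa> * lam i * z i ^ r"
    and lam: "\<forall>i\<in>{1..q}. lam i > 0"
  shows "gibbs V G q E lam walk_measure"
  unfolding gibbs_def
proof (intro conjI allI impI)
  show "prob_space walk_measure" by (rule walk.prob_space_axioms)
  show "sets walk_measure = sets (hom_space V G q E)" by (simp add: walk_measure_def)
  fix U \<sigma> assume U: "finite U \<and> U \<subseteq> V"
  obtain n0 where n0: "U \<subseteq> {v \<in> V. length v \<le> n0}" using finite_sites_subset_ball U by blast
  define F where "F = outside_alg V G q E U"
  define f :: "(nat list \<Rightarrow> nat) \<Rightarrow> real"
    where "f = indicator {\<phi> \<in> space walk_measure. \<forall>u\<in>U. \<phi> u = \<sigma> u}"
  define g where "g = spec_cond V G q E lam U \<sigma>"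
  define pw where "pw = (\<lambda>\<sigma> \<psi>. patch_weight V G q E lam U \<sigma> \<psi>)"
  define tot where "tot = (\<lambda>\<psi>. \<Sum>\<tau>\<in>PiE U (\<lambda>_. {1..q}). pw \<tau> \<psi>)"
  have bdry: "finite (bdry V G U)" "bdry V G U \<subseteq> V - U"
    using finite_subset[OF bdry_subset_ball[OF n0] finite_ball] by (auto simp: bdry_def)
  have "outside_alg V G q E U = sigma \<Omega> (coordinate_events \<Omega> (V - U))"
    unfolding outside_alg_def space_hom_space coordinate_events_def ..
  then have F: "sets F = sigma_sets \<Omega> (coordinate_events \<Omega> (V - U))" "space F = \<Omega>"
    by (simp_all add: F_def sets_measure_of[OF coordinate_events_subset] space_measure_of[OF coordinate_events_subset])
  have sub: "subalgebra walk_measure F"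
    unfolding subalgebra_def F sets_walk_measure
    by (intro conjI sigma_sets_mono') (auto simp: coordinate_events_def)
  interpret sigma_finite_subalgebra walk_measure F
    by (rule finite_measure_subalgebra_is_sigma_finite)
      (intro finite_measure_subalgebra.intro finite_measure_subalgebra_axioms.intro walk.finite_measure_axioms sub)
  have g_eq: "g \<psi> = pw \<sigma> \<psi> / tot \<psi>" if "\<forall>v\<in>bdry V G U. \<psi> v \<in> {1..q}" for \<psi>
    unfolding g_def pw_def tot_def using U bdry lam that by (intro spec_cond_eq_patch_weight) auto
  have pw: "0 \<le> pw \<sigma> \<psi>" "pw \<sigma> \<psi> \<le> tot \<psi>" for \<psi>
    unfolding pw_def tot_def using patch_weight_nonneg[OF lam] patch_weight_le_sum[OF lam] U by blast+
  have g01: "0 \<le> g \<psi> \<and> g \<psi> \<le> 1" if "\<psi> \<in> \<Omega>" for \<psi>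
  proof -
    have "g \<psi> = pw \<sigma> \<psi> / tot \<psi>" using homs_range[OF that] bdry by (intro g_eq) auto
    then show ?thesis using pw[of \<psi>] by (auto simp: divide_le_eq_1)
  qed
  have g_cong: "g \<phi> = g \<psi>" if "\<And>v. v \<in> bdry V G U \<Longrightarrow> \<phi> v = \<psi> v" for \<phi> \<psi>
    unfolding g_def using that by (rule spec_cond_cong)
  have g_meas: "g \<in> borel_measurable F"
  proof (rule measurableI)
    fix A :: "real set"
    show "g -` A \<inter> space F \<in> sets F"
    proof (rule determined_in_sigma_algebra[of \<Omega> _ "bdry V G U" "{1..q}"])
      show "sigma_algebra \<Omega> (sets F)" using sets.sigma_algebra_axioms[of F] F by simp
      show "cylinder \<Omega> (bdry V G U) \<psi> \<in> sets F" for \<psi>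
        unfolding F by (rule cylinder_in_coordinate_algebra) (use bdry in auto)
      show "\<eta> \<in> g -` A \<inter> space F"
        if "\<phi> \<in> g -` A \<inter> space F" "\<eta> \<in> \<Omega>" "\<And>v. v \<in> bdry V G U \<Longrightarrow> \<phi> v = \<eta> v" for \<phi> \<eta>
        using g_cong[of \<phi> \<eta>] that F by simp
    qed (use bdry F homs_range in auto)
  qed simp
  have cap: "cylinder \<Omega> W \<psi> \<inter> \<Omega> = cylinder \<Omega> W \<psi>" for W \<psi>
    using cylinder_subset by (rule Int_absorb2)
  have f_cyl: "f = indicator (cylinder \<Omega> U \<sigma>)" by (simp add: f_def cylinder_def)
  have cylU: "cylinder \<Omega> U \<sigma> \<in> sets walk_measure" using U by (intro cylinder_measurable) auto
  have f_int: "integrable walk_measure f"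
    unfolding f_cyl using cylU by (simp add: integrable_indicator_iff cap less_top[symmetric])
  have g_int: "integrable walk_measure g"
  proof (rule walk.integrable_const_bound[where B = 1])
    show "AE x in walk_measure. norm (g x) \<le> 1" using g01 by (intro AE_I2) auto
    show "g \<in> borel_measurable walk_measure" by (rule measurable_from_subalg[OF sub g_meas])
  qed
  \<comment> \<open>The radius starts at \<open>Suc n0\<close>, so every \<open>D n\<close> contains
    the boundary of \<open>U\<close> and \<open>g\<close> is constant on each cylinder over
    \<open>D n\<close>.\<close>
  define D where "D = (\<lambda>n. {v \<in> V. length v \<le> Suc (n0 + n)} - U)"
  have D: "finite (D n)" "D n \<subseteq> V" for n
    unfolding D_def using finite_ball[of r "Suc (n0 + n)"] by auto
  have bdry_D: "bdry V G U \<subseteq> D n" for n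
    using bdry_subset_ball[OF n0] bdry(2) unfolding D_def by auto
  have integrals_eq: "(LINT x:cylinder \<Omega> (D n) \<psi>|walk_measure. f x) = (LINT x:cylinder \<Omega> (D n) \<psi>|walk_measure. g x)"
    for n \<psi>
  proof -
    let ?B = "{v \<in> V. length v \<le> Suc (n0 + n)}"
    let ?C = "cylinder \<Omega> (D n) \<psi>"
    have C: "?C \<in> sets walk_measure" using D by (rule cylinder_measurable)
    have DU: "D n \<union> U = ?B" "D n \<inter> U = {}" using n0 unfolding D_def by auto
    have "U \<subseteq> {v \<in> V. length v \<le> n0 + n}" using n0 by auto
    from prob_cylinder_patch[OF kap this] obtain c where
      c: "\<And>\<tau>. walk.prob (cylinder \<Omega> ?B (override_on \<psi> \<tau> U)) = c * pw \<tau> \<psi>"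
      unfolding pw_def by blast
    have "?C \<inter> cylinder \<Omega> U \<sigma> = cylinder \<Omega> ?B (override_on \<psi> \<sigma> U)"
      unfolding DU(1)[symmetric] using DU(2) by (auto simp: cylinder_def override_on_def)
    then have "indicator ?C x *\<^sub>R f x = indicator (cylinder \<Omega> ?B (override_on \<psi> \<sigma> U)) x" for x
      unfolding f_cyl by (metis indicator_inter_arith real_scaleR_def)
    then have lf: "(LINT x:?C|walk_measure. f x) = c * pw \<sigma> \<psi>"
      unfolding set_lebesgue_integral_def using c[of \<sigma>] by (simp add: cap)
    have lg: "indicator ?C x *\<^sub>R g x = g \<psi> * indicator ?C x" for x
    proof (cases "x \<in> ?C")
      case True
      then have "g x = g \<psi>" using bdry_D[of n] by (intro g_cong) (auto simp: cylinder_def)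
      then show ?thesis by simp
    qed simp
    have lg: "(LINT x:?C|walk_measure. g x) = g \<psi> * walk.prob ?C"
      unfolding set_lebesgue_integral_def by (simp only: lg) (simp add: cap)
    show ?thesis
    proof (cases "\<forall>v\<in>D n. \<psi> v \<in> {1..q}")
      case True
      have gp: "g \<psi> = pw \<sigma> \<psi> / tot \<psi>" using True bdry_D[of n] by (intro g_eq) blast
      have "walk.prob ?C = (\<Sum>\<tau>\<in>PiE U (\<lambda>_. {1..q}). walk.prob (cylinder \<Omega> (D n \<union> U) (override_on \<psi> \<tau> U)))"
        by (rule measure_cylinder_split[OF walk.finite_measure_axioms DU(2)])
          (use U homs_range cylinder_measurable[of "D n \<union> U"] D in auto)
      also have "\<dots> = c * tot \<psi>" unfolding DU c tot_def sum_distrib_left ..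
      finally have "g \<psi> * walk.prob ?C = c * pw \<sigma> \<psi> * (tot \<psi> / tot \<psi>)"
        using gp by simp
      \<comment> \<open>If \<open>tot \<psi>\<close> is zero, the quotient is 0 by the convention
        for division, and \<open>pw \<sigma> \<psi> \<le> tot \<psi>\<close> makes the right side
        vanish too.\<close>
      also have "\<dots> = c * pw \<sigma> \<psi>" using pw[of \<psi>] by (cases "tot \<psi> = 0") auto
      finally show ?thesis unfolding lf lg by simp
    next
      case False
      then have "?C = {}" using homs_range D(2)[of n] by (fastforce simp: cylinder_def)
      then show ?thesis by (simp add: set_lebesgue_integral_def)
    qed
  qed
  define nu where "nu = (\<lambda>h. restr_to_subalg (density walk_measure (\<lambda>x. ennreal (h x))) F)"
  have subd: "subalgebra (density walk_measure h) F" for h using sub by (simp add: subalgebra_def)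
  have nu: "emeasure (nu h) A = ennreal (LINT x:A|walk_measure. h x)" 
    if h: "integrable walk_measure h" "\<And>x. x \<in> \<Omega> \<Longrightarrow> 0 \<le> h x" and A: "A \<in> sets F" for h A
  proof -
    have A': "A \<in> sets walk_measure" using A sub by (auto simp: subalgebra_def)
    have "emeasure (nu h) A = (\<integral>\<^sup>+x. ennreal (h x) * indicator A x \<partial>walk_measure)"
      unfolding nu_def emeasure_restr_to_subalg[OF subd A] using h A' by (intro emeasure_density) auto
    also have "\<dots> = (\<integral>\<^sup>+x. ennreal (indicator A x *\<^sub>R h x) \<partial>walk_measure)"
      by (intro nn_integral_cong) (auto simp: indicator_def)
    also have "\<dots> = ennreal (LINT x:A|walk_measure. h x)"
      unfolding set_lebesgue_integral_def
      using integrable_mult_indicator[OF A' h(1)] h(2)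
      by (intro nn_integral_eq_integral) (auto intro!: AE_I2 simp: indicator_def)
    finally show ?thesis .
  qed
  have f0: "0 \<le> f x" for x unfolding f_def by simp
  have "nu f = nu g"
  proof (rule exhaustion_measure_eqI[where D = D and S = "V - U" and C = "{1..q}" and \<Omega> = \<Omega>])
    show "incseq D" unfolding D_def incseq_def by auto
    show "(\<Union>n. D n) = V - U"
    proof (intro equalityI subsetI)
      fix v assume "v \<in> V - U"
      then have "v \<in> D (length v)" unfolding D_def by simp
      then show "v \<in> (\<Union>n. D n)" by blast
    qed (auto simp: D_def)
    show "sets (nu f) = sigma_sets \<Omega> (coordinate_events \<Omega> (V - U))"
      "sets (nu g) = sigma_sets \<Omega> (coordinate_events \<Omega> (V - U))"
      unfolding nu_def sets_restr_to_subalg[OF subd] F by simp_all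
    have "\<Omega> \<in> sets F" using sets.top[of F] F by simp
    moreover have "space (nu f) = \<Omega>" by (simp add: nu_def space_restr_to_subalg)
    ultimately show "finite_measure (nu f)" using nu[OF f_int f0] by (intro finite_measureI) simp
    have "cylinder \<Omega> (D n) \<psi> \<in> sets F" for n \<psi>
      unfolding F by (rule cylinder_in_coordinate_algebra) (use D in \<open>auto simp: D_def\<close>)
    then show "emeasure (nu f) (cylinder \<Omega> (D n) \<psi>) = emeasure (nu g) (cylinder \<Omega> (D n) \<psi>)" for n \<psi>
      using nu[OF f_int f0] nu[OF g_int] g01 integrals_eq by simp
  qed (use D homs_range in auto)
  have "AE x in walk_measure. real_cond_exp walk_measure F f x = g x"
  proof (rule real_cond_exp_charact)
    fix A assume A: "A \<in> sets F"
    have "ennreal (LINT x:A|walk_measure. f x) = ennreal (LINT x:A|walk_measure. g x)"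
      using nu[OF f_int f0 A] nu[OF g_int _ A] g01 \<open>nu f = nu g\<close> by simp
    moreover have "0 \<le> (LINT x:A|walk_measure. f x)"
      unfolding set_lebesgue_integral_def using f0 by (intro integral_nonneg_AE AE_I2) simp
    moreover have "0 \<le> (LINT x:A|walk_measure. g x)"
      unfolding set_lebesgue_integral_def using g01 by (intro integral_nonneg_AE AE_I2) simp
    ultimately show "(LINT x:A|walk_measure. f x) = (LINT x:A|walk_measure. g x)" by simp
  qed (fact f_int g_int g_meas)+
  then show "AE \<psi> in walk_measure. (\<forall>u\<in>U. \<psi> u = \<sigma> u) \<longrightarrow>
      real_cond_exp walk_measure (outside_alg V G q E U)
        (indicator {\<phi> \<in> space walk_measure. \<forall>u\<in>U. \<phi> u = \<sigma> u}) \<psi> = spec_cond V G q E lam U \<sigma> \<psi>"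
    unfolding F_def f_def g_def by (auto elim: eventually_mono)
qed

end

theorem theorem5p2:
  fixes r q :: nat and E :: "nat \<Rightarrow> nat \<Rightarrow> bool" and lam :: "nat \<Rightarrow> real"
  assumes "r \<ge> 2"
    and "constraint_graph q E"
    and "cg_connected q E"
    and "\<exists>i j. E i j"
    and "\<forall>i\<in>{1..q}. lam i > 0"
  shows "\<exists>w. (\<forall>i\<in>{1..q}. w i > 0) \<and>
           (\<exists>\<mu>. walk_law r q E w \<mu> \<and>
                simple_gibbs (tree_sites r) (tree_adj r) q E lam \<mu> \<and>
                invariant_meas (tree_sites r) (tree_adj r) q E \<mu>)"
proof -
  obtain i0 j0 where edge: "E i0 j0" using assms(4) by blast
  have rng: "i \<in> {1..q} \<and> j \<in> {1..q}" if "E i j" for i j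
    using assms(2) that unfolding constraint_graph_def by blast
  obtain w c where w: "\<And>i. i \<in> {1..q} \<Longrightarrow> w i > 0 \<and> w i = c * lam i * zw q E w i ^ r"
  proof -
    have "1 \<le> r" using assms(1) by simp
    from weight_equations_solvable[OF this assms(2,3) edge assms(5)] show thesis using that by blast
  qed
  interpret weighted_walk r q E w
  proof
    show "constraint_graph q E" by (rule assms(2))
    show "q \<ge> 1" using rng[OF edge] by simp
    show "w i > 0" if "i \<in> {1..q}" for i using w[OF that] by simp
    \<comment> \<open>A path from \<open>i\<close> to the end \<open>i0\<close> of the given edge
      has a first step; if \<open>i = i0\<close>, the edge itself provides a neighbour.\<close>
    show "nbhd q E i \<noteq> {}" if i: "i \<in> {1..q}" for i
    proof -
      have "E\<^sup>*\<^sup>* i i0" using assms(3) i rng[OF edge] unfolding cg_connected_def by blast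
      then obtain j where "E i j" using edge by (cases rule: converse_rtranclpE) auto
      then show ?thesis using rng unfolding nbhd_def by blast
    qed
  qed
  have "gibbs (tree_sites r) (tree_adj r) q E lam walk_measure"
    by (rule gibbs_walk_measure[where \<kappa> = c]) (use w assms(5) in blast)+
  then have "simple_gibbs (tree_sites r) (tree_adj r) q E lam walk_measure"
    unfolding simple_gibbs_def by (intro conjI ballI impI walk_indep_branches)
  then show ?thesis
    using weight_pos walk_law_walk_measure invariant_walk_measure by blast
qed

end
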